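(* Let $m\le n$. Let $\mathbb{R}^n$ be equipped with any norm and suppose that the norm on $\mathbb{R}^m$ is strictly convex. Suppose that $\mathcal{F}$ is a locally uniformly closed subset of the $1$-Lipschitz maps of $\mathbb{R}^n$ to $\mathbb{R}^m$. Suppose that $\mathcal{F}$ has the property that for any absolutely continuous measure $\mu\in\mathcal{W}_1(\mathbb{R}^n,\mathbb{R}^m)$ and any $u_0\in\mathcal{F}$ such that $$\int_{\mathbb{R}^n}\langle u_0,d\mu\rangle=\sup\Big\{\int_{\mathbb{R}^n}\langle u,d\mu\rangle\;\Big|\;u\in\mathcal{F}\Big\}$$ we have $\mu(A)=0$ for any transport set $A$ of $u_0$. Then either $m=1$, or $m>1$ and then any $u\in\mathcal{F}$ is affine, $m=n$, and $\mathbb{R}^n$ and $\mathbb{R}^m$ with the considered norms are isometric. Moreover, any $\mathcal{F}$-optimal potential is an isometry on a maximal subspace $V\subset\mathbb{R}^n$, so that for any absolutely continuous $\mu$ there is a linear subspace $V\subset\mathbb{R}^n$ such that $$\mu(\{x\in\mathbb{R}^n\mid P^{\perp}x\in A\})=0\quad\text{for any Borel set }A\subset V^{\perp}.\tag{$*$}$$ Here $P^{\perp}$ denotes the orthogonal projection onto the orthogonal complement $V^{\perp}$ of $V$. If any $\mathcal{F}$-optimal potential is an isometry on a maximal subspace $V\subset\mathbb{R}^n$ such that $( * )$ holds true, then $\mu(A)=0$ for any transport set $A$ of its $\mathcal{F}$-optimal potential.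
   Context: The norms on $\mathbb{R}^n$ and $\mathbb{R}^m$ are not required to be Euclidean. "Isometry" means a distance-preserving map with respect to the considered norms. "Absolutely continuous" refers to the Lebesgue measure on $\mathbb{R}^n$. $\mathcal{W}_1(\mathbb{R}^n,\mathbb{R}^m)$ is the space of $\mathbb{R}^m$-valued Borel measures $\mu$ on $\mathbb{R}^n$ with $\mu(\mathbb{R}^n)=0$ and $\int\|x-x_0\|\,d\|\mu\|(x)<\infty$ for some $x_0$, where $\|\mu\|$ is the total variation of $\mu$. $\langle\cdot,\cdot\rangle$ is the standard scalar product. If $\mu\in\mathcal{W}_1(\mathbb{R}^n,\mathbb{R}^m)$ and $u_0\in\mathcal{F}$ attains the supremum of $\int\langle u,d\mu\rangle$ over $u\in\mathcal{F}$, then $u_0$ is called an $\mathcal{F}$-optimal potential of $\mu$. A leaf of a $1$-Lipschitz map $u$ is a maximal (with respect to inclusion) set $\mathcal{S}\subset\mathbb{R}^n$ such that $u|_{\mathcal{S}}$ is an isometry. $B(u)$ is the set of points belonging to at least two distinct leaves of $u$. A transport set of $u$ is a Borel set $A\subset\mathbb{R}^n$ such that if $x\in A\setminus B(u)$ and $y\in\mathbb{R}^n$ satisfy $\|u(x)-u(y)\|=\|x-y\|$, then $y\in A$. A "maximal subspace" on which $u$ is an isometry is a linear subspace that is maximal with respect to inclusion among linear subspaces $V$ such that $u|_V$ is an isometry.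
   Formalization: F is assumed non-empty, and local uniform closedness is assumed of F modulo additive constants (the set of all u + c with u in F) instead of F itself, since otherwise optimal potentials may fail to exist and the claim is false. *)

theory Defs
  imports "HOL-Analysis.Analysis"
begin

section \<open>Norms\<close>

text \<open>The type \<open>real ^ 'n\<close> carries the Euclidean norm as a type class instance; the arbitrary
  norms of the source and target spaces are therefore explicit functions.  The topology, the Borel
  sets and the Lebesgue measure do not depend on the norm, so the library's are used.\<close>

definition is_norm :: "('a::real_vector \<Rightarrow> real) \<Rightarrow> bool" where
  "is_norm N \<longleftrightarrow>
     (\<forall>x. 0 \<le> N x) \<and> (\<forall>x. N x = 0 \<longleftrightarrow> x = 0) \<and>
     (\<forall>c x. N (c *\<^sub>R x) = \<bar>c\<bar> * N x) \<and> (\<forall>x y. N (x + y) \<le> N x + N y)"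

definition is_strictly_convex_norm :: "('a::real_vector \<Rightarrow> real) \<Rightarrow> bool" where
  "is_strictly_convex_norm N \<longleftrightarrow> is_norm N \<and>
     (\<forall>x y t. N x = 1 \<and> N y = 1 \<and> x \<noteq> y \<and> 0 < t \<and> t < 1 \<longrightarrow>
        N ((1 - t) *\<^sub>R x + t *\<^sub>R y) < 1)"


section \<open>Maps between normed spaces\<close>

definition one_lipschitz ::
  "('a::real_vector \<Rightarrow> real) \<Rightarrow> ('b::real_vector \<Rightarrow> real) \<Rightarrow> ('a \<Rightarrow> 'b) \<Rightarrow> bool" where
  "one_lipschitz N M u \<longleftrightarrow> (\<forall>x y. M (u x - u y) \<le> N (x - y))"

definition isometry_on ::
  "('a::real_vector \<Rightarrow> real) \<Rightarrow> ('b::real_vector \<Rightarrow> real) \<Rightarrow> 'a set \<Rightarrow> ('a \<Rightarrow> 'b) \<Rightarrow> bool" where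
  "isometry_on N M S u \<longleftrightarrow> (\<forall>x\<in>S. \<forall>y\<in>S. M (u x - u y) = N (x - y))"

definition isometric_norms ::
  "('a::real_vector \<Rightarrow> real) \<Rightarrow> ('b::real_vector \<Rightarrow> real) \<Rightarrow> bool" where
  "isometric_norms N M \<longleftrightarrow> (\<exists>f. bij f \<and> isometry_on N M UNIV f)"

definition affine_map :: "('a::real_vector \<Rightarrow> 'b::real_vector) \<Rightarrow> bool" where
  "affine_map u \<longleftrightarrow> (\<exists>L b. linear L \<and> (\<forall>x. u x = L x + b))"

text \<open>The topology of locally uniform convergence on maps between Euclidean spaces is metrizable,
  so closedness is sequential closedness; locally uniform convergence on a locally compact space is
  uniform convergence on compact sets.\<close>

definition locally_uniformly_closed :: "('a::euclidean_space \<Rightarrow> 'b::euclidean_space) set \<Rightarrow> bool" where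
  "locally_uniformly_closed G \<longleftrightarrow>
     (\<forall>f g. (\<forall>k. f k \<in> G) \<and> (\<forall>K. compact K \<longrightarrow> uniform_limit K f g sequentially) \<longrightarrow> g \<in> G)"

text \<open>A measure of total mass zero does not distinguish maps that differ by a constant; this is
  the family \<open>F\<close> regarded modulo additive constants.  Closedness of \<open>F\<close> in this sense is
  what makes optimal potentials exist: a set such as \<open>{u\<^sub>k + c\<^sub>k | k}\<close> with \<open>\<parallel>c\<^sub>k\<parallel> \<rightarrow> \<infinity>\<close> has no
  convergent sequences of distinct members, whatever the maps \<open>u\<^sub>k\<close> with \<open>u\<^sub>k 0 = 0\<close> are.\<close>

definition up_to_constants :: "('a \<Rightarrow> 'b::ab_group_add) set \<Rightarrow> ('a \<Rightarrow> 'b) set" where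
  "up_to_constants F = {\<lambda>x. u x + c | u c. u \<in> F}"


section \<open>Leaves and transport sets\<close>

definition leaf ::
  "('a::real_vector \<Rightarrow> real) \<Rightarrow> ('b::real_vector \<Rightarrow> real) \<Rightarrow> ('a \<Rightarrow> 'b) \<Rightarrow> 'a set \<Rightarrow> bool" where
  "leaf N M u S \<longleftrightarrow>
     isometry_on N M S u \<and> (\<forall>T. isometry_on N M T u \<and> S \<subseteq> T \<longrightarrow> T = S)"

definition branch_set ::
  "('a::real_vector \<Rightarrow> real) \<Rightarrow> ('b::real_vector \<Rightarrow> real) \<Rightarrow> ('a \<Rightarrow> 'b) \<Rightarrow> 'a set" where
  "branch_set N M u = {x. \<exists>S T. leaf N M u S \<and> leaf N M u T \<and> S \<noteq> T \<and> x \<in> S \<and> x \<in> T}"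

definition transport_set ::
  "('a::euclidean_space \<Rightarrow> real) \<Rightarrow> ('b::real_vector \<Rightarrow> real) \<Rightarrow> ('a \<Rightarrow> 'b) \<Rightarrow> 'a set \<Rightarrow> bool" where
  "transport_set N M u A \<longleftrightarrow> A \<in> sets borel \<and>
     (\<forall>x \<in> A - branch_set N M u. \<forall>y. M (u x - u y) = N (x - y) \<longrightarrow> y \<in> A)"

definition maximal_isometric_subspace ::
  "('a::real_vector \<Rightarrow> real) \<Rightarrow> ('b::real_vector \<Rightarrow> real) \<Rightarrow> ('a \<Rightarrow> 'b) \<Rightarrow> 'a set \<Rightarrow> bool" where
  "maximal_isometric_subspace N M u V \<longleftrightarrow> subspace V \<and> isometry_on N M V u \<and>
     (\<forall>W. subspace W \<and> isometry_on N M W u \<and> V \<subseteq> W \<longrightarrow> W = V)"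


section \<open>Vector measures\<close>

text \<open>A vector measure is a set function of which only the values on Borel sets matter.\<close>

definition vector_measure :: "('a::topological_space set \<Rightarrow> 'b::real_normed_vector) \<Rightarrow> bool" where
  "vector_measure \<mu> \<longleftrightarrow> \<mu> {} = 0 \<and>
     (\<forall>A :: nat \<Rightarrow> 'a set. range A \<subseteq> sets borel \<and> disjoint_family A \<longrightarrow>
        (\<lambda>i. \<mu> (A i)) sums \<mu> (\<Union>i. A i))"

definition total_variation ::
  "('b \<Rightarrow> real) \<Rightarrow> ('a::topological_space set \<Rightarrow> 'b) \<Rightarrow> 'a measure" where
  "total_variation M \<mu> = measure_of UNIV (sets borel)
     (\<lambda>A. SUP P \<in> {P. finite P \<and> P \<subseteq> sets borel \<and> disjoint P \<and> \<Union>P = A}.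
        \<Sum>B\<in>P. ennreal (M (\<mu> B)))"

text \<open>The positive part in the Jordan decomposition of a signed measure; the negative part of
  \<open>\<nu>\<close> is the positive part of \<open>- \<nu>\<close>.  Negative values are truncated by \<^const>\<open>ennreal\<close>,
  harmlessly, as \<open>B = {}\<close> is admitted.\<close>

definition positive_part :: "('a::topological_space set \<Rightarrow> real) \<Rightarrow> 'a measure" where
  "positive_part \<nu> = measure_of UNIV (sets borel)
     (\<lambda>A. SUP B \<in> {B \<in> sets borel. B \<subseteq> A}. ennreal (\<nu> B))"

definition signed_integral ::
  "('a::topological_space \<Rightarrow> real) \<Rightarrow> ('a set \<Rightarrow> real) \<Rightarrow> real" where
  "signed_integral f \<nu> =
     (LINT x | positive_part \<nu>. f x) - (LINT x | positive_part (\<lambda>A. - \<nu> A). f x)"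

definition vector_integral ::
  "('a::topological_space \<Rightarrow> real ^ 'm) \<Rightarrow> ('a set \<Rightarrow> real ^ 'm) \<Rightarrow> real" where
  "vector_integral u \<mu> = (\<Sum>i\<in>UNIV. signed_integral (\<lambda>x. u x $ i) (\<lambda>A. \<mu> A $ i))"

definition W1 ::
  "('a::euclidean_space \<Rightarrow> real) \<Rightarrow> ('b::euclidean_space \<Rightarrow> real) \<Rightarrow> ('a set \<Rightarrow> 'b) set" where
  "W1 N M = {\<mu>. vector_measure \<mu> \<and> \<mu> UNIV = 0 \<and>
     (\<exists>x0. (\<integral>\<^sup>+x. ennreal (N (x - x0)) \<partial>total_variation M \<mu>) < \<infinity>)}"

definition lebesgue_ac :: "('a::euclidean_space set \<Rightarrow> 'b::zero) \<Rightarrow> bool" where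
  "lebesgue_ac \<mu> \<longleftrightarrow> (\<forall>A \<in> null_sets lborel. \<mu> A = 0)"

definition optimal_potential ::
  "(real ^ 'n \<Rightarrow> real ^ 'm) set \<Rightarrow> ((real ^ 'n) set \<Rightarrow> real ^ 'm) \<Rightarrow> (real ^ 'n \<Rightarrow> real ^ 'm) \<Rightarrow> bool" where
  "optimal_potential F \<mu> u0 \<longleftrightarrow> u0 \<in> F \<and>
     ereal (vector_integral u0 \<mu>) = (SUP u\<in>F. ereal (vector_integral u \<mu>))"

definition orthogonal_projection :: "'a::euclidean_space set \<Rightarrow> 'a \<Rightarrow> 'a" where
  "orthogonal_projection S x = (THE y. y \<in> S \<and> (\<forall>s\<in>S. orthogonal (x - y) s))"

definition balanced_along ::
  "'a::euclidean_space set \<Rightarrow> ('a set \<Rightarrow> 'b::zero) \<Rightarrow> bool" where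
  "balanced_along V \<mu> \<longleftrightarrow>
     (\<forall>A \<in> sets borel. A \<subseteq> V\<^sup>\<bottom> \<longrightarrow> \<mu> {x. orthogonal_projection (V\<^sup>\<bottom>) x \<in> A} = 0)"

text \<open>Absolutely continuous measures give mass zero to every transport set of each of their
  \<open>F\<close>-optimal potentials.\<close>

definition mass_balance ::
  "(real ^ 'n \<Rightarrow> real) \<Rightarrow> (real ^ 'm \<Rightarrow> real) \<Rightarrow> (real ^ 'n \<Rightarrow> real ^ 'm) set \<Rightarrow> bool" where
  "mass_balance N M F \<longleftrightarrow>
     (\<forall>\<mu> \<in> W1 N M. lebesgue_ac \<mu> \<longrightarrow>
        (\<forall>u0. optimal_potential F \<mu> u0 \<longrightarrow> (\<forall>A. transport_set N M u0 A \<longrightarrow> \<mu> A = 0)))"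

end

theory Submission
  imports Defs "HOL-Complex_Analysis.Great_Picard"
begin

text \<open>
  \<^emph>\<open>Mass balance forces affine maps.\<close>  Off the branch set the relation
  \<open>\<parallel>u x - u y\<parallel> = \<parallel>x - y\<parallel>\<close> is an equivalence relation whose classes are the leaves.  Spread the weights
  \<open>w + \<epsilon> v\<close>, \<open>w - \<epsilon> v\<close>, \<open>- 2 w\<close>, where \<open>v\<close> is orthogonal to \<open>w\<close> (here \<open>m > 1\<close> is used), over small
  balls around \<open>a\<close>, \<open>b\<close> and their midpoint \<open>c\<close>.  The weights satisfy only one linear relation, so mass balance
  makes every transport set of an optimal potential occupy equal fractions of the three balls, and some leaf meets all three.
  When the radii and \<open>\<epsilon>\<close> tend to zero, a limit of optimal potentials is isometric on \<open>{a, b, c}\<close>;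
  strict convexity makes it affine there, so that the supremum is zero in the limit.  Hence
  \<open>\<langle>u a + u b - 2 u c, w\<rangle> \<le> 0\<close> for all \<open>u \<in> F\<close> and all \<open>w\<close>, and \<open>u\<close> is affine.

  \<^emph>\<open>Affine potentials.\<close>  For an affine \<open>u\<close> with linear part \<open>L\<close> put \<open>E = {v. \<parallel>L v\<parallel> = \<parallel>v\<parallel>}\<close>.
  Either every point is a branch point, so that every Borel set is a transport set and the measure vanishes, or \<open>E\<close> is a subspace, all
  \<open>E\<close>-invariant Borel sets are transport sets, and the measure is balanced along \<open>E\<close>.  A measure that is not balanced
  along any proper subspace therefore has only isometries as optimal potentials, which gives \<open>m = n\<close>.

  \<^emph>\<open>The converse.\<close>  By hypothesis a measure that is not balanced along any proper subspace has only
  isometries, hence affine maps, as optimal potentials.  Testing with such measures that annihilate the affine maps shows that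
  \<open>F\<close> consists of affine maps.  Optimality for \<open>\<mu>\<close> then depends on the first moments of \<open>\<mu>\<close> only, so
  \<open>\<mu>\<close> can be replaced by a measure with the same moments that is not balanced along any proper subspace; the
  potential is an isometry and its transport sets are trivial.
\<close>

section \<open>Norms and strict convexity\<close>

context
  fixes N :: "'a::real_vector \<Rightarrow> real"
  assumes N: "is_norm N"
begin

lemma is_norm_nonneg: "0 \<le> N x"
  and is_norm_eq_0: "N x = 0 \<longleftrightarrow> x = 0"
  and is_norm_scale: "N (c *\<^sub>R x) = \<bar>c\<bar> * N x"
  and is_norm_triangle: "N (x + y) \<le> N x + N y"
  using N unfolding is_norm_def by blast+

lemma is_norm_zero: "N 0 = 0"
  using is_norm_eq_0 by blast

lemma is_norm_minus: "N (- x) = N x"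
  using is_norm_scale[of "-1" x] by simp

lemma is_norm_diff_commute: "N (x - y) = N (y - x)"
  using is_norm_minus[of "x - y"] by simp

lemma is_norm_abs_diff: "\<bar>N x - N y\<bar> \<le> N (x - y)"
  using is_norm_triangle[of "x - y" y] is_norm_triangle[of "y - x" x] is_norm_diff_commute[of x y]
  by simp

lemma is_norm_sum: "N (\<Sum>i\<in>I. f i) \<le> (\<Sum>i\<in>I. N (f i))"
proof (induction I rule: infinite_finite_induct)
  case (insert i I)
  then show ?case using is_norm_triangle[of "f i" "sum f I"] by simp
qed (auto simp: is_norm_zero)

end

section \<open>Comparison of an arbitrary norm with the Euclidean norm\<close>

lemma is_norm_upper:
  fixes N :: "'a::euclidean_space \<Rightarrow> real"
  assumes N: "is_norm N"
  obtains C where "C > 0" "\<And>x. N x \<le> C * norm x"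
proof -
  define C where "C = (\<Sum>b\<in>Basis. N b) + 1"
  have "N x \<le> C * norm x" for x
  proof -
    have "N x = N (\<Sum>b\<in>Basis. (x \<bullet> b) *\<^sub>R b)"
      by (simp add: euclidean_representation)
    also have "\<dots> \<le> (\<Sum>b\<in>Basis. \<bar>x \<bullet> b\<bar> * N b)"
      using is_norm_sum[OF N, of "\<lambda>b. (x \<bullet> b) *\<^sub>R b" Basis] by (simp add: is_norm_scale[OF N])
    also have "\<dots> \<le> (\<Sum>b\<in>Basis. norm x * N b)"
      by (intro sum_mono mult_right_mono Basis_le_norm is_norm_nonneg[OF N])
    also have "\<dots> \<le> C * norm x"
      by (simp add: C_def sum_distrib_left algebra_simps)
    finally show ?thesis .
  qed
  moreover have "C > 0"
    unfolding C_def by (intro add_nonneg_pos sum_nonneg is_norm_nonneg[OF N]) auto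
  ultimately show ?thesis using that by blast
qed

lemma is_norm_continuous:
  fixes N :: "'a::euclidean_space \<Rightarrow> real"
  assumes N: "is_norm N"
  shows "continuous_on UNIV N"
proof -
  obtain C where C: "C > 0" "\<And>x. N x \<le> C * norm x" using is_norm_upper[OF N] by blast
  have "C-lipschitz_on UNIV N"
    using C is_norm_abs_diff[OF N] by (intro lipschitz_onI) (auto simp: dist_norm intro: order_trans)
  then show ?thesis by (rule lipschitz_on_continuous_on)
qed

lemma is_norm_continuous_on:
  fixes N :: "'a::euclidean_space \<Rightarrow> real"
  assumes "is_norm N" "continuous_on S f"
  shows "continuous_on S (\<lambda>x. N (f x))"
  using continuous_on_compose2[OF is_norm_continuous[OF assms(1)] assms(2)] by simp

lemma is_norm_lower:
  fixes N :: "'a::euclidean_space \<Rightarrow> real"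
  assumes N: "is_norm N"
  obtains c where "c > 0" "\<And>x. c * norm x \<le> N x"
proof -
  have ne: "sphere (0::'a) 1 \<noteq> {}" by simp
  have "continuous_on (sphere 0 1) N"
    using is_norm_continuous[OF N] continuous_on_subset by blast
  from continuous_attains_inf[OF compact_sphere ne this]
  obtain s where s: "norm s = 1" "\<And>y. norm y = 1 \<Longrightarrow> N s \<le> N y" by auto
  have "N s * norm x \<le> N x" for x
  proof (cases "x = 0")
    case False
    then have "N s \<le> N ((1 / norm x) *\<^sub>R x)" by (intro s) simp
    also have "\<dots> = N x / norm x" by (subst is_norm_scale[OF N]) simp
    finally show ?thesis using False by (simp add: field_simps)
  qed (simp add: is_norm_zero[OF N])
  moreover have "N s > 0"
    using s(1) is_norm_eq_0[OF N, of s] is_norm_nonneg[OF N, of s] by fastforce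
  ultimately show ?thesis using that by blast
qed

text \<open>The equality case of the triangle inequality: after division by \<open>s\<close>, two
  distinct unit vectors would have a midpoint of norm 1. It serves to show that maps preserving the
  distances of a point pair and its midpoint send the midpoint to the midpoint.\<close>

lemma strictly_convex_norm_eq:
  assumes M: "is_strictly_convex_norm M"
    and p: "M p = s" and q: "M q = s" and pq: "M (p + q) = 2 * s"
  shows "p = q"
proof (rule ccontr)
  assume ne: "p \<noteq> q"
  have N: "is_norm M" using M unfolding is_strictly_convex_norm_def by blast
  have s: "s > 0"
  proof (rule ccontr)
    assume "\<not> s > 0"
    then have "s = 0" using is_norm_nonneg[OF N, of p] p by simp
    then show False using p q ne is_norm_eq_0[OF N] by metis
  qed
  have "M ((1/s) *\<^sub>R p) = 1" "M ((1/s) *\<^sub>R q) = 1" "(1/s) *\<^sub>R p \<noteq> (1/s) *\<^sub>R q"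
    using s p q ne by (simp_all add: is_norm_scale[OF N])
  moreover have "0 < (1/2::real)" "(1/2::real) < 1" by simp_all
  ultimately have "M ((1 - 1/2) *\<^sub>R ((1/s) *\<^sub>R p) + (1/2) *\<^sub>R ((1/s) *\<^sub>R q)) < 1"
    using M unfolding is_strictly_convex_norm_def by blast
  moreover have "(1 - 1/2) *\<^sub>R ((1/s) *\<^sub>R p) + (1/2) *\<^sub>R ((1/s) *\<^sub>R q) = (1 / (2 * s)) *\<^sub>R (p + q)"
    by (simp add: scaleR_add_right)
  ultimately show False using s pq by (simp add: is_norm_scale[OF N])
qed

lemma strictly_convex_imp_norm: "is_strictly_convex_norm M \<Longrightarrow> is_norm M"
  unfolding is_strictly_convex_norm_def by blast

lemma one_lipschitz_bound:
  fixes N :: "'a::euclidean_space \<Rightarrow> real" and M :: "'b::euclidean_space \<Rightarrow> real"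
  assumes N: "is_norm N" and M: "is_norm M"
  obtains C where "C > 0" "\<And>u x y. one_lipschitz N M u \<Longrightarrow> norm (u x - u y) \<le> C * norm (x - y)"
proof -
  obtain C where C: "C > 0" "\<And>x. N x \<le> C * norm x" using is_norm_upper[OF N] by blast
  obtain c where c: "c > 0" "\<And>x. c * norm x \<le> M x" using is_norm_lower[OF M] by blast
  have "norm (u x - u y) \<le> (C / c) * norm (x - y)" if "one_lipschitz N M u" for u x y
  proof -
    have "c * norm (u x - u y) \<le> C * norm (x - y)"
      using c(2)[of "u x - u y"] C(2)[of "x - y"] that unfolding one_lipschitz_def
      by (meson order_trans)
    then show ?thesis using c(1) by (simp add: field_simps)
  qed
  then show ?thesis using that[of "C / c"] C c by simp
qed

lemma one_lipschitz_continuous: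
  fixes N :: "'a::euclidean_space \<Rightarrow> real" and M :: "'b::euclidean_space \<Rightarrow> real"
  assumes "is_norm N" "is_norm M" "one_lipschitz N M u"
  shows "continuous_on S u"
proof -
  obtain C where "C > 0" "\<And>x y. norm (u x - u y) \<le> C * norm (x - y)"
    using one_lipschitz_bound[OF assms(1,2)] assms(3) by metis
  then have "C-lipschitz_on S u"
    by (intro lipschitz_onI) (auto simp: dist_norm)
  then show ?thesis by (rule lipschitz_on_continuous_on)
qed

section \<open>From midpoint identities to affine maps\<close>

lemma continuous_additive_linear:
  fixes f :: "'a::real_normed_vector \<Rightarrow> 'b::real_normed_vector"
  assumes add: "\<And>x y. f (x + y) = f x + f y" and cont: "continuous_on UNIV f"
  shows "linear f"
proof (rule linearI)
  show "f (x + y) = f x + f y" for x y by (rule add)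
  have f0: "f 0 = 0" using add[of 0 0] by simp
  have fm: "f (- x) = - f x" for x
    using add[of x "- x"] f0 by (simp add: eq_neg_iff_add_eq_0 add.commute)
  have nat: "f (of_nat k *\<^sub>R x) = of_nat k *\<^sub>R f x" for k :: nat and x
    by (induction k) (auto simp: f0 add scaleR_left_distrib)
  have int: "f (of_int k *\<^sub>R x) = of_int k *\<^sub>R f x" for k :: int and x
    using nat[of "nat \<bar>k\<bar>" x] fm[of "of_nat (nat \<bar>k\<bar>) *\<^sub>R x"]
    by (cases "k \<ge> 0") auto
  have rat: "f (q *\<^sub>R x) = q *\<^sub>R f x" if "q \<in> \<rat>" for q x
  proof -
    from that obtain a b :: int where b: "b > 0" and q: "q = of_int a / of_int b"
      by (elim Rats_cases') auto
    have "of_int b *\<^sub>R f (q *\<^sub>R x) = f (of_int b *\<^sub>R q *\<^sub>R x)" by (rule int[symmetric])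
    also have "of_int b *\<^sub>R q *\<^sub>R x = of_int a *\<^sub>R x" using b by (simp add: q)
    also have "f \<dots> = of_int b *\<^sub>R q *\<^sub>R f x" using b by (simp add: int q)
    finally have "of_int b *\<^sub>R (f (q *\<^sub>R x) - q *\<^sub>R f x) = 0"
      by (simp add: scaleR_diff_right)
    then show ?thesis using b by simp
  qed
  fix r :: real and x
  \<comment> \<open>Homogeneity holds on a closed set of scalars, and this set contains the dense
    rationals.\<close>
  have 1: "continuous_on UNIV (\<lambda>r. f (r *\<^sub>R x) - r *\<^sub>R f x)"
    by (intro continuous_intros continuous_on_compose2[OF cont]) auto
  have "closed {r. f (r *\<^sub>R x) - r *\<^sub>R f x = 0}"
    using continuous_closed_vimage[OF closed_singleton[of 0], of "\<lambda>r. f (r *\<^sub>R x) - r *\<^sub>R f x"] 1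
    by (auto simp: vimage_def continuous_on_eq_continuous_at)
  moreover have "\<rat> \<subseteq> {r. f (r *\<^sub>R x) - r *\<^sub>R f x = 0}" using rat by auto
  ultimately have "closure \<rat> \<subseteq> {r. f (r *\<^sub>R x) - r *\<^sub>R f x = 0}"
    by (rule closure_minimal[rotated])
  then show "f (r *\<^sub>R x) = r *\<^sub>R f x" using Rats_closure_real by auto
qed

text \<open>The pairs \<open>(x, y)\<close> and \<open>(x + y, 0)\<close> share their midpoint;
  comparing the two identities makes \<open>u - u 0\<close> additive.\<close>

lemma midpoint_affine_map:
  fixes u :: "'a::real_normed_vector \<Rightarrow> 'b::real_normed_vector"
  assumes mid: "\<And>a b. u a + u b - 2 *\<^sub>R u ((1/2) *\<^sub>R (a + b)) = 0" and cont: "continuous_on UNIV u"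
  shows "affine_map u"
proof -
  define g where "g x = u x - u 0" for x
  have "g (x + y) = g x + g y" for x y
  proof -
    have "u x + u y = 2 *\<^sub>R u ((1/2) *\<^sub>R (x + y))" using mid[of x y] by simp
    moreover have "u (x + y) + u 0 = 2 *\<^sub>R u ((1/2) *\<^sub>R (x + y))" using mid[of "x + y" 0] by simp
    ultimately have "u x + u y = u (x + y) + u 0" by simp
    then show ?thesis unfolding g_def by (simp add: algebra_simps)
  qed
  moreover have "continuous_on UNIV g" unfolding g_def by (intro continuous_intros cont)
  ultimately have "linear g" by (rule continuous_additive_linear)
  then show ?thesis unfolding affine_map_def g_def by (metis diff_add_cancel)
qed

text \<open>The image of a midpoint lies at half the distance from both image points, and strict
  convexity of the target leaves only one such point. This takes the place of surjectivity in the
  Mazur-Ulam theorem.\<close>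

lemma isometry_affine_map:
  fixes N :: "'a::euclidean_space \<Rightarrow> real" and M :: "'b::euclidean_space \<Rightarrow> real"
  assumes N: "is_norm N" and M: "is_strictly_convex_norm M" and iso: "isometry_on N M UNIV u"
  shows "affine_map u"
proof (rule midpoint_affine_map)
  have M': "is_norm M" by (rule strictly_convex_imp_norm[OF M])
  have iso': "M (u x - u y) = N (x - y)" for x y using iso unfolding isometry_on_def by blast
  then have "one_lipschitz N M u" unfolding one_lipschitz_def by simp
  then show "continuous_on UNIV u" by (rule one_lipschitz_continuous[OF N M'])
  fix a b :: 'a
  define c where "c = (1/2) *\<^sub>R (a + b)"
  have c: "a + b = c + c" unfolding c_def by (simp flip: scaleR_left_distrib)
  then have "a - c = c - b" "a - b = 2 *\<^sub>R (a - c)"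
    by (simp_all add: algebra_simps scaleR_2)
  then have "u a - u c = u c - u b"
    by (intro strictly_convex_norm_eq[OF M, of _ "N (a - c)"])
      (simp_all add: iso' is_norm_scale[OF N])
  then show "u a + u b - 2 *\<^sub>R u ((1/2) *\<^sub>R (a + b)) = 0"
    unfolding c_def by (simp add: algebra_simps scaleR_2)
qed

section \<open>Leaves and transport sets\<close>

text \<open>Leaves are the maximal cliques of this relation.\<close>

definition isometric_pair ::
  "('a::real_vector \<Rightarrow> real) \<Rightarrow> ('b::real_vector \<Rightarrow> real) \<Rightarrow> ('a \<Rightarrow> 'b) \<Rightarrow> 'a \<Rightarrow> 'a \<Rightarrow> bool" where
  "isometric_pair N M u x y \<longleftrightarrow> M (u x - u y) = N (x - y)"

lemma isometry_on_iff_pairs: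
  "isometry_on N M S u \<longleftrightarrow> (\<forall>x\<in>S. \<forall>y\<in>S. isometric_pair N M u x y)"
  unfolding isometry_on_def isometric_pair_def ..

lemma isometric_pair_refl:
  "is_norm N \<Longrightarrow> is_norm M \<Longrightarrow> isometric_pair N M u x x"
  unfolding isometric_pair_def by (simp add: is_norm_zero)

lemma isometric_pair_sym:
  "is_norm N \<Longrightarrow> is_norm M \<Longrightarrow> isometric_pair N M u x y \<longleftrightarrow> isometric_pair N M u y x"
  unfolding isometric_pair_def by (metis is_norm_diff_commute)

text \<open>Zorn's lemma applies because being isometric is a condition on pairs of points, and two
  points of the union of a chain already lie in a common member.\<close>

lemma leaf_extends:
  assumes "isometry_on N M S u"
  obtains T where "leaf N M u T" "S \<subseteq> T"
proof -
  let ?A = "{T. isometry_on N M T u \<and> S \<subseteq> T}"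
  have "\<Union>C \<in> ?A" if ne: "C \<noteq> {}" and C: "subset.chain ?A C" for C
  proof -
    have CA: "T \<in> ?A" if "T \<in> C" for T using that C unfolding subset_chain_def by blast
    have "M (u x - u y) = N (x - y)" if xy: "x \<in> \<Union>C" "y \<in> \<Union>C" for x y
    proof -
      obtain X Y where XY: "X \<in> C" "Y \<in> C" "x \<in> X" "y \<in> Y" using xy by blast
      then have "X \<subseteq> Y \<or> Y \<subseteq> X" using C unfolding subset_chain_def by blast
      then obtain T where "T \<in> C" "x \<in> T" "y \<in> T" using XY by blast
      then show ?thesis using CA[of T] unfolding isometry_on_def by simp
    qed
    moreover have "S \<subseteq> \<Union>C" using ne CA by blast
    ultimately show ?thesis unfolding isometry_on_def by simp
  qed
  moreover have "?A \<noteq> {}" using assms by blast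
  ultimately obtain T where T: "T \<in> ?A" "\<forall>X\<in>?A. T \<subseteq> X \<longrightarrow> X = T"
    using subset_Zorn_nonempty[of ?A] by auto
  show ?thesis
  proof (rule that[of T])
    show "leaf N M u T" unfolding leaf_def using T by (metis (mono_tags, lifting) mem_Collect_eq order_trans)
    show "S \<subseteq> T" using T(1) by blast
  qed
qed

text \<open>Branching is failure of transitivity at \<open>x\<close>. If all partners of
  \<open>x\<close> are partners of each other, they form an isometric set that contains every leaf
  through \<open>x\<close>, so there is only one leaf; otherwise \<open>{x, y}\<close> and
  \<open>{x, z}\<close> extend to different leaves.\<close>

lemma branch_set_iff:
  assumes N: "is_norm N" and M: "is_norm M"
  shows "x \<in> branch_set N M u \<longleftrightarrow>
    (\<exists>y z. isometric_pair N M u x y \<and> isometric_pair N M u x z \<and> \<not> isometric_pair N M u y z)"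
    (is "_ \<longleftrightarrow> ?R")
proof
  note sym = isometric_pair_sym[OF N M, of u] and refl = isometric_pair_refl[OF N M, of u]
  show ?R if x: "x \<in> branch_set N M u"
  proof (rule ccontr)
    assume not: "\<not> ?R"
    obtain S T where ST: "leaf N M u S" "leaf N M u T" "S \<noteq> T" "x \<in> S" "x \<in> T"
      using x unfolding branch_set_def by blast
    let ?X = "{y. isometric_pair N M u x y}"
    have X: "isometry_on N M ?X u" unfolding isometry_on_iff_pairs using not by blast
    have "S \<subseteq> ?X" "T \<subseteq> ?X" using ST unfolding leaf_def isometry_on_iff_pairs by blast+
    then have "S = ?X" "T = ?X" using ST X unfolding leaf_def by blast+
    then show False using ST by blast
  qed
  show "x \<in> branch_set N M u" if R: ?R
  proof -
    from R obtain y z where yz: "isometric_pair N M u x y" "isometric_pair N M u x z"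
      "\<not> isometric_pair N M u y z" by blast
    have "isometry_on N M {x, y} u" "isometry_on N M {x, z} u"
      unfolding isometry_on_iff_pairs using yz refl sym[of x] by simp_all
    then obtain S T where ST: "leaf N M u S" "{x, y} \<subseteq> S" "leaf N M u T" "{x, z} \<subseteq> T"
      using leaf_extends by metis
    have "S \<noteq> T" using ST yz(3) unfolding leaf_def isometry_on_iff_pairs by blast
    then show ?thesis unfolding branch_set_def using ST by blast
  qed
qed

lemma closed_isometric_pair:
  fixes N :: "'a::euclidean_space \<Rightarrow> real" and M :: "'b::euclidean_space \<Rightarrow> real"
    and f g :: "'c::topological_space \<Rightarrow> 'a"
  assumes N: "is_norm N" and M: "is_norm M" and u: "one_lipschitz N M u"
    and f: "continuous_on UNIV f" and g: "continuous_on UNIV g"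
  shows "closed {x. isometric_pair N M u (f x) (g x)}"
  unfolding isometric_pair_def
  by (intro closed_Collect_eq is_norm_continuous_on[OF M] is_norm_continuous_on[OF N] continuous_intros
      continuous_on_compose2[OF one_lipschitz_continuous[OF N M u, of UNIV]] f g) auto

text \<open>The branch set is the projection of a set of triples described by two closed conditions
  and one strict inequality. A slack of \<open>1 / Suc k\<close> in the inequality and a ball of
  radius \<open>k\<close> exhaust this set by compact sets, whose projections are compact.\<close>

lemma branch_set_borel:
  fixes N :: "'a::euclidean_space \<Rightarrow> real" and M :: "'b::euclidean_space \<Rightarrow> real"
  assumes N: "is_norm N" and M: "is_norm M" and u: "one_lipschitz N M u"
  shows "branch_set N M u \<in> sets borel"
proof -
  define K :: "nat \<Rightarrow> ('a \<times> 'a \<times> 'a) set" where "K k = cball 0 (real k) \<inter>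
    ({p. isometric_pair N M u (fst p) (fst (snd p))} \<inter> {p. isometric_pair N M u (fst p) (snd (snd p))} \<inter>
     {p. M (u (fst (snd p)) - u (snd (snd p))) + 1 / Suc k \<le> N (fst (snd p) - snd (snd p))})" for k
  have "compact (K k)" for k
    unfolding K_def
    by (intro compact_Int_closed compact_cball closed_Int closed_isometric_pair[OF N M u]
        closed_Collect_le is_norm_continuous_on[OF M] is_norm_continuous_on[OF N] continuous_intros
        continuous_on_compose2[OF one_lipschitz_continuous[OF N M u, of UNIV]]) auto
  then have "compact (fst ` K k)" for k
    by (intro compact_continuous_image continuous_intros)
  then have "(\<Union>k. fst ` K k) \<in> sets borel"
    by (intro sets.countable_UN) (auto intro!: borel_closed compact_imp_closed)
  also have "(\<Union>k. fst ` K k) = branch_set N M u"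
  proof (intro equalityI subsetI)
    fix x assume "x \<in> (\<Union>k. fst ` K k)"
    then obtain k y z where "isometric_pair N M u x y" "isometric_pair N M u x z"
      and "M (u y - u z) + 1 / Suc k \<le> N (y - z)" unfolding K_def by auto
    moreover from this(3) have "\<not> isometric_pair N M u y z" unfolding isometric_pair_def
      using divide_pos_pos[of 1 "1 + real k"] by force
    ultimately show "x \<in> branch_set N M u" unfolding branch_set_iff[OF N M] by blast
  next
    fix x assume "x \<in> branch_set N M u"
    then obtain y z where *: "isometric_pair N M u x y" "isometric_pair N M u x z"
      "\<not> isometric_pair N M u y z" unfolding branch_set_iff[OF N M] by blast
    then have "N (y - z) - M (u y - u z) > 0"
      using u unfolding one_lipschitz_def isometric_pair_def by (metis diff_gt_0_iff_gt less_eq_real_def)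
    from reals_Archimedean[OF this] obtain j where j: "1 / Suc j < N (y - z) - M (u y - u z)"
      by (auto simp: inverse_eq_divide)
    obtain i where i: "norm (x, y, z) \<le> real i" using real_arch_simple by blast
    have "1 / Suc (max i j) \<le> 1 / Suc j" by (intro divide_left_mono) auto
    then have "(x, y, z) \<in> K (max i j)"
      unfolding K_def using * i j by simp
    then show "x \<in> (\<Union>k. fst ` K k)" by force
  qed
  finally show ?thesis .
qed

text \<open>Off the branch set the relation \<^const>\<open>isometric_pair\<close> is an equivalence, so the union of
  its classes meeting a set that avoids the branch set is a transport set.\<close>

lemma transport_set_compact_saturation:
  fixes N :: "'a::euclidean_space \<Rightarrow> real" and M :: "'b::euclidean_space \<Rightarrow> real"
  assumes N: "is_norm N" and M: "is_norm M" and u: "one_lipschitz N M u"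
    and K: "compact K" and disj: "K \<inter> branch_set N M u = {}"
  shows "transport_set N M u {y. \<exists>x\<in>K. isometric_pair N M u x y}"
  unfolding transport_set_def
proof (intro conjI ballI allI impI)
  note sym = isometric_pair_sym[OF N M, of u]
  let ?A = "{y. \<exists>x\<in>K. isometric_pair N M u x y}"
  \<comment> \<open>The saturation is the projection of a closed relation along the compact factor
    \<open>K\<close>, hence closed; this is the reason for taking \<open>K\<close> compact.\<close>
  have "closed {(x, y). isometric_pair N M u x y}"
    using closed_isometric_pair[OF N M u, of fst snd] by (simp add: case_prod_unfold continuous_on_fst continuous_on_snd)
  from closed_compact_projection[OF K this] show "?A \<in> sets borel"
    by (simp add: Bex_def borel_closed)
  fix y z assume y: "y \<in> ?A - branch_set N M u" and "M (u y - u z) = N (y - z)"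
  then have yz: "isometric_pair N M u y z" unfolding isometric_pair_def by simp
  from y obtain x where x: "x \<in> K" "isometric_pair N M u x y" by blast
  have "isometric_pair N M u x z"
    using y x(2) yz sym[of x y] unfolding Diff_iff branch_set_iff[OF N M] by blast
  then show "z \<in> ?A" using x by blast
qed

section \<open>Vector measures\<close>

lemma vector_measure_empty: "vector_measure \<mu> \<Longrightarrow> \<mu> {} = 0"
  unfolding vector_measure_def by blast

lemma vector_measure_sums:
  "vector_measure \<mu> \<Longrightarrow> (\<And>i::nat. A i \<in> sets borel) \<Longrightarrow> disjoint_family A \<Longrightarrow>
    (\<lambda>i. \<mu> (A i)) sums \<mu> (\<Union>i. A i)"
  unfolding vector_measure_def by (simp add: image_subset_iff)

lemma vector_measure_union:
  assumes \<mu>: "vector_measure \<mu>" and "A \<in> sets borel" "B \<in> sets borel" "A \<inter> B = {}"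
  shows "\<mu> (A \<union> B) = \<mu> A + \<mu> B"
proof -
  have "(\<lambda>i. \<mu> (binaryset A B i)) sums \<mu> (\<Union>i. binaryset A B i)"
    using assms by (intro vector_measure_sums) (auto simp: binaryset_def disjoint_family_on_def)
  moreover have "(\<lambda>i. \<mu> (binaryset A B i)) sums (\<mu> A + \<mu> B)"
    using binaryset_sums[of \<mu> A B] vector_measure_empty[OF \<mu>] by blast
  ultimately show ?thesis by (simp add: UN_binaryset_eq sums_unique2)
qed

lemma vector_measure_diff:
  assumes \<mu>: "vector_measure \<mu>" and "A \<in> sets borel" "B \<in> sets borel" "B \<subseteq> A"
  shows "\<mu> (A - B) = \<mu> A - \<mu> B"
  using vector_measure_union[OF \<mu>, of B "A - B"] assms
  by (simp add: Un_absorb1 Un_absorb2)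

lemma vector_measure_component:
  fixes \<mu> :: "'a::topological_space set \<Rightarrow> real ^ 'm"
  assumes "vector_measure \<mu>"
  shows "vector_measure (\<lambda>A. \<mu> A $ i)"
  using assms unfolding vector_measure_def
  by (auto intro: bounded_linear.sums[OF bounded_linear_vec_nth])

lemma vector_measure_uminus:
  "vector_measure \<mu> \<Longrightarrow> vector_measure (\<lambda>A. - \<mu> A)"
  unfolding vector_measure_def by (auto intro: sums_minus)

section \<open>The positive part and the total variation as measures\<close>

lemma ennreal_add_le: "ennreal (x + y) \<le> ennreal x + ennreal y"
proof (cases "x \<ge> 0 \<and> y \<ge> 0")
  case False
  then have "ennreal (x + y) \<le> ennreal x \<or> ennreal (x + y) \<le> ennreal y"
    by (auto intro!: ennreal_leI)
  then show ?thesis by (auto intro: add_increasing add_increasing2)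
qed simp

text \<open>Subadditivity bounds \<phi> of every partial sum, and continuity passes to the limit.
  With the identity for \<phi> this gives countable subadditivity of the positive part, with a norm
  that of the total variation.\<close>

lemma ennreal_sublinear_vector_measure_le_suminf:
  fixes \<mu> :: "'a::topological_space set \<Rightarrow> 'b::real_normed_vector" and \<phi> :: "'b \<Rightarrow> real"
  assumes \<mu>: "vector_measure \<mu>" and cont: "continuous_on UNIV \<phi>" and \<phi>0: "\<phi> 0 = 0"
    and sub: "\<And>x y. \<phi> (x + y) \<le> \<phi> x + \<phi> y"
    and A: "\<And>i::nat. A i \<in> sets borel" "disjoint_family A" and B: "B \<in> sets borel" "B \<subseteq> (\<Union>i. A i)"
  shows "ennreal (\<phi> (\<mu> B)) \<le> (\<Sum>i. ennreal (\<phi> (\<mu> (B \<inter> A i))))"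
proof -
  have "(\<lambda>i. \<mu> (B \<inter> A i)) sums \<mu> (\<Union>i. B \<inter> A i)"
    using A B by (intro vector_measure_sums[OF \<mu>]) (auto simp: disjoint_family_on_def)
  also have "(\<Union>i. B \<inter> A i) = B" using B by blast
  finally have "(\<lambda>k. \<Sum>i<k. \<mu> (B \<inter> A i)) \<longlonglongrightarrow> \<mu> B" unfolding sums_def .
  then have "(\<lambda>k. ennreal (\<phi> (\<Sum>i<k. \<mu> (B \<inter> A i)))) \<longlonglongrightarrow> ennreal (\<phi> (\<mu> B))"
    by (intro tendsto_ennrealI continuous_on_tendsto_compose[OF cont]) auto
  moreover have "ennreal (\<phi> (\<Sum>i<k. \<mu> (B \<inter> A i))) \<le> (\<Sum>i. ennreal (\<phi> (\<mu> (B \<inter> A i))))" for k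
  proof -
    have "ennreal (\<phi> (\<Sum>i<k. \<mu> (B \<inter> A i))) \<le> (\<Sum>i<k. ennreal (\<phi> (\<mu> (B \<inter> A i))))"
    proof (induction k)
      case (Suc k)
      have "ennreal (\<phi> (\<Sum>i<Suc k. \<mu> (B \<inter> A i)))
        \<le> ennreal (\<phi> (\<Sum>i<k. \<mu> (B \<inter> A i)) + \<phi> (\<mu> (B \<inter> A k)))"
        by (simp add: sub ennreal_leI)
      also have "\<dots> \<le> ennreal (\<phi> (\<Sum>i<k. \<mu> (B \<inter> A i))) + ennreal (\<phi> (\<mu> (B \<inter> A k)))"
        by (rule ennreal_add_le)
      also have "\<dots> \<le> (\<Sum>i<Suc k. ennreal (\<phi> (\<mu> (B \<inter> A i))))"
        using Suc by simp
      finally show ?case .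
    qed (simp add: \<phi>0)
    also have "\<dots> \<le> (\<Sum>i. ennreal (\<phi> (\<mu> (B \<inter> A i))))"
      by (intro sum_le_suminf) auto
    finally show ?thesis .
  qed
  ultimately show ?thesis by (intro LIMSEQ_le_const2) auto
qed

lemma ennreal_SUP_add_SUP_le:
  fixes f :: "'i \<Rightarrow> ennreal"
  assumes "X \<noteq> {}" "Y \<noteq> {}" and le: "\<And>x y. x \<in> X \<Longrightarrow> y \<in> Y \<Longrightarrow> f x + g y \<le> c"
  shows "(SUP x\<in>X. f x) + (SUP y\<in>Y. g y) \<le> c"
proof -
  have "(SUP x\<in>X. f x) + (SUP y\<in>Y. g y) = (SUP x\<in>X. f x + (SUP y\<in>Y. g y))"
    using assms(1) by (rule ennreal_SUP_add_left[symmetric])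
  also have "\<dots> = (SUP x\<in>X. SUP y\<in>Y. f x + g y)"
    using assms(2) by (intro SUP_cong refl) (simp add: ennreal_SUP_add_right)
  also have "\<dots> \<le> c" by (intro SUP_least le)
  finally show ?thesis .
qed

text \<open>\<open>measure_of\<close> returns the zero measure unless its set function is a measure.
  For suprema one inequality is easy on pairs and the other on sequences: superadditivity gives
  monotonicity and bounds the partial sums, and \<open>sub\<close> supplies the converse.\<close>

lemma emeasure_measure_of_additive:
  fixes g :: "'a::topological_space set \<Rightarrow> ennreal"
  assumes empty: "g {} = 0"
    and super: "\<And>A B. A \<in> sets borel \<Longrightarrow> B \<in> sets borel \<Longrightarrow> A \<inter> B = {} \<Longrightarrow> g A + g B \<le> g (A \<union> B)"
    and sub: "\<And>A :: nat \<Rightarrow> 'a set. (\<And>i. A i \<in> sets borel) \<Longrightarrow> disjoint_family A \<Longrightarrow> g (\<Union>i. A i) \<le> (\<Sum>i. g (A i))"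
    and A: "A \<in> sets borel"
  shows "emeasure (measure_of UNIV (sets borel) g) A = g A"
proof (rule emeasure_measure_of[OF refl])
  have sets: "sets (measure_of UNIV (sets borel) g) = sets borel"
    using sets.sets_measure_of_eq[of "borel :: 'a measure" g] by simp
  show "A \<in> sets (measure_of UNIV (sets borel) g)" using A sets by simp
  show "positive (sets (measure_of UNIV (sets borel) g)) g" using empty by (simp add: positive_def)
  show "countably_additive (sets (measure_of UNIV (sets borel) g)) g"
    unfolding countably_additive_def sets
  proof (intro allI impI)
    fix A :: "nat \<Rightarrow> 'a set"
    assume "range A \<subseteq> sets borel" and disj: "disjoint_family A" and U: "(\<Union>i. A i) \<in> sets borel"
    then have A: "A i \<in> sets borel" for i by blast
    have "(\<Sum>i<k. g (A i)) \<le> g (\<Union>i<k. A i)" for k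
    proof (induction k)
      case (Suc k)
      have "(\<Sum>i<Suc k. g (A i)) \<le> g (\<Union>i<k. A i) + g (A k)"
        using add_right_mono[OF Suc] by simp
      also have "\<dots> \<le> g ((\<Union>i<k. A i) \<union> A k)"
      proof (intro super sets.finite_UN)
        have "A i \<inter> A k = {}" if "i < k" for i
          using disj that unfolding disjoint_family_on_def by auto
        then show "(\<Union>i<k. A i) \<inter> A k = {}" by blast
      qed (use A in auto)
      also have "(\<Union>i<k. A i) \<union> A k = (\<Union>i<Suc k. A i)" by (auto simp: less_Suc_eq)
      finally show ?case .
    qed (simp add: empty)
    moreover have "g (\<Union>i<k. A i) \<le> g (\<Union>i. A i)" for k
    proof -
      have "g (\<Union>i<k. A i) \<le> g (\<Union>i<k. A i) + g ((\<Union>i. A i) - (\<Union>i<k. A i))" by simp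
      also have "\<dots> \<le> g ((\<Union>i<k. A i) \<union> ((\<Union>i. A i) - (\<Union>i<k. A i)))"
      proof (rule super)
        show 1: "(\<Union>i<k. A i) \<in> sets borel" using A by (intro sets.finite_UN) auto
        show "(\<Union>i. A i) - (\<Union>i<k. A i) \<in> sets borel" by (rule sets.Diff[OF U 1])
      qed blast
      also have "(\<Union>i<k. A i) \<union> ((\<Union>i. A i) - (\<Union>i<k. A i)) = (\<Union>i. A i)" by blast
      finally show ?thesis .
    qed
    ultimately have "(\<Sum>i. g (A i)) \<le> g (\<Union>i. A i)"
      by (intro suminf_le_const summableI) (blast intro: order_trans)
    then show "(\<Sum>i. g (A i)) = g (\<Union>i. A i)" using sub[OF A disj] by (rule antisym)
  qed
qed simp

lemma sets_positive_part [simp, measurable_cong]: "sets (positive_part \<nu>) = sets borel"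
  and sets_total_variation [simp, measurable_cong]: "sets (total_variation M \<mu>) = sets borel"
  unfolding positive_part_def total_variation_def
  by (rule sets.sets_measure_of_eq[of borel, unfolded space_borel])+

lemma space_positive_part [simp]: "space (positive_part \<nu>) = UNIV"
  and space_total_variation [simp]: "space (total_variation M \<mu>) = UNIV"
  unfolding positive_part_def total_variation_def by (simp_all add: space_measure_of)

lemma emeasure_positive_part:
  fixes \<nu> :: "'a::topological_space set \<Rightarrow> real"
  assumes \<nu>: "vector_measure \<nu>" and A: "A \<in> sets borel"
  shows "emeasure (positive_part \<nu>) A = (SUP B \<in> {B \<in> sets borel. B \<subseteq> A}. ennreal (\<nu> B))"
  unfolding positive_part_def
proof (rule emeasure_measure_of_additive[OF _ _ _ A])
  note [simp] = vector_measure_empty[OF \<nu>]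
  let ?g = "\<lambda>A. SUP B \<in> {B \<in> sets borel. B \<subseteq> A}. ennreal (\<nu> B)"
  have eq: "{B. B = {} \<and> B \<in> sets borel} = {{}}" by auto
  show "?g {} = 0" by (simp add: conj_commute eq)
  show "?g A + ?g B \<le> ?g (A \<union> B)" if AB: "A \<in> sets borel" "B \<in> sets borel" "A \<inter> B = {}" for A B
  proof (rule ennreal_SUP_add_SUP_le)
    fix X Y assume X: "X \<in> {B \<in> sets borel. B \<subseteq> A}" and Y: "Y \<in> {Y \<in> sets borel. Y \<subseteq> B}"
    \<comment> \<open>A set of negative mass contributes 0 after truncation, and so does the empty
      set. The replacement makes both values nonnegative, so that truncation commutes with their
      sum.\<close>
    define X' where "X' = (if \<nu> X \<ge> 0 then X else {})"
    define Y' where "Y' = (if \<nu> Y \<ge> 0 then Y else {})"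
    have *: "X' \<in> sets borel" "Y' \<in> sets borel" "X' \<inter> Y' = {}" "X' \<union> Y' \<subseteq> A \<union> B"
      using X Y AB by (auto simp: X'_def Y'_def split: if_splits)
    have "ennreal (\<nu> X) + ennreal (\<nu> Y) = ennreal (\<nu> X') + ennreal (\<nu> Y')"
      by (auto simp: X'_def Y'_def ennreal_neg)
    also have "\<dots> = ennreal (\<nu> (X' \<union> Y'))"
      using vector_measure_union[OF \<nu> *(1-3)]
      by (subst ennreal_plus[symmetric]) (auto simp: X'_def Y'_def)
    also have "\<dots> \<le> ?g (A \<union> B)" using * by (intro SUP_upper) auto
    finally show "ennreal (\<nu> X) + ennreal (\<nu> Y) \<le> ?g (A \<union> B)" .
  qed auto
  show "?g (\<Union>i. A i) \<le> (\<Sum>i. ?g (A i))" if A: "\<And>i. A i \<in> sets borel" "disjoint_family A" for A :: "nat \<Rightarrow> _"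
  proof (rule SUP_least)
    fix B assume B: "B \<in> {B \<in> sets borel. B \<subseteq> (\<Union>i. A i)}"
    have "ennreal (\<nu> B) \<le> (\<Sum>i. ennreal (\<nu> (B \<inter> A i)))"
      using ennreal_sublinear_vector_measure_le_suminf[OF \<nu>, of "\<lambda>x. x" A B] A B by auto
    also have "\<dots> \<le> (\<Sum>i. ?g (A i))"
      using A B by (intro suminf_le SUP_upper summableI) auto
    finally show "ennreal (\<nu> B) \<le> (\<Sum>i. ?g (A i))" .
  qed
qed

lemma emeasure_total_variation:
  fixes M :: "'b::euclidean_space \<Rightarrow> real" and \<mu> :: "'a::topological_space set \<Rightarrow> 'b"
  assumes M: "is_norm M" and \<mu>: "vector_measure \<mu>" and A: "A \<in> sets borel"
  shows "emeasure (total_variation M \<mu>) A =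
    (SUP P \<in> {P. finite P \<and> P \<subseteq> sets borel \<and> disjoint P \<and> \<Union>P = A}. \<Sum>B\<in>P. ennreal (M (\<mu> B)))"
  unfolding total_variation_def
proof (rule emeasure_measure_of_additive[OF _ _ _ A])
  note [simp] = vector_measure_empty[OF \<mu>] is_norm_zero[OF M]
  let ?P = "\<lambda>A. {P. finite P \<and> P \<subseteq> sets borel \<and> disjoint P \<and> \<Union>P = A}"
  let ?s = "\<lambda>P. \<Sum>B\<in>P. ennreal (M (\<mu> B))"
  let ?g = "\<lambda>A. SUP P \<in> ?P A. ?s P"
  have "?s P = 0" if "P \<in> ?P {}" for P
    using that by (intro sum.neutral) auto
  then have "?g {} \<le> 0" by (intro SUP_least) simp
  then show "?g {} = 0" by simp
  have ne: "?P A \<noteq> {}" if "A \<in> sets borel" for A :: "'a set"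
  proof -
    have "{A} \<in> ?P A" using that by (simp add: disjoint_def)
    then show ?thesis by blast
  qed
  show "?g A + ?g B \<le> ?g (A \<union> B)" if AB: "A \<in> sets borel" "B \<in> sets borel" "A \<inter> B = {}" for A B
  proof (rule ennreal_SUP_add_SUP_le[OF ne[OF AB(1)] ne[OF AB(2)]])
    fix P Q assume P: "P \<in> ?P A" and Q: "Q \<in> ?P B"
    \<comment> \<open>Pieces of disjoint sets can coincide only if they are empty, so the union of
      the two partitions counts no mass twice.\<close>
    have int: "P \<inter> Q \<subseteq> {{}}" using P Q AB by blast
    then have "?s (P \<inter> Q) = 0" by (intro sum.neutral) auto
    then have "?s P + ?s Q = ?s (P \<union> Q)"
      using P Q sum.union_inter[of P Q "\<lambda>B. ennreal (M (\<mu> B))"] by simp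
    also have "P \<union> Q \<in> ?P (A \<union> B)"
      using P Q AB by (auto simp: disjoint_def) blast+
    then have "?s (P \<union> Q) \<le> ?g (A \<union> B)" by (rule SUP_upper)
    finally show "?s P + ?s Q \<le> ?g (A \<union> B)" .
  qed
  show "?g (\<Union>i. A i) \<le> (\<Sum>i. ?g (A i))" if A: "\<And>i. A i \<in> sets borel" "disjoint_family A" for A :: "nat \<Rightarrow> _"
  proof (rule SUP_least)
    fix P assume P: "P \<in> ?P (\<Union>i. A i)"
    have "?s P \<le> (\<Sum>B\<in>P. \<Sum>i. ennreal (M (\<mu> (B \<inter> A i))))"
      using P A
      by (intro sum_mono ennreal_sublinear_vector_measure_le_suminf[OF \<mu> is_norm_continuous[OF M]]
          is_norm_triangle[OF M]) auto
    also have "\<dots> = (\<Sum>i. \<Sum>B\<in>P. ennreal (M (\<mu> (B \<inter> A i))))"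
      by (rule suminf_sum[symmetric]) simp
    also have "\<dots> \<le> (\<Sum>i. ?g (A i))"
    proof (intro suminf_le summableI)
      fix i
      let ?f = "\<lambda>B. B \<inter> A i"
      have "disjoint (?f ` P)" using P unfolding disjoint_def by blast
      then have PA: "?f ` P \<in> ?P (A i)" using P A by auto
      \<comment> \<open>Distinct pieces are disjoint, so they have the same trace on
        \<open>A i\<close> only if both traces are empty; reindexing by traces loses no
        mass.\<close>
      have z: "ennreal (M (\<mu> (?f B))) = 0" if "B \<in> P" "C \<in> P" "B \<noteq> C" "?f B = ?f C" for B C
      proof -
        have "?f B = {}" using that P unfolding disjoint_def by blast
        then show ?thesis by simp
      qed
      have "?s (?f ` P) = (\<Sum>B\<in>P. ennreal (M (\<mu> (?f B))))"
        using P z by (subst sum.reindex_nontrivial) auto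
      then show "(\<Sum>B\<in>P. ennreal (M (\<mu> (B \<inter> A i)))) \<le> ?g (A i)"
        using SUP_upper[OF PA, of ?s] by simp
    qed
    finally show "?s P \<le> (\<Sum>i. ?g (A i))" .
  qed
qed

text \<open>If \<nu> is unbounded on the subsets of a set, the set splits into a part that is still
  unbounded and a rest of mass at least 1 in absolute value. Iteration sheds disjoint sets whose
  masses do not tend to zero, contradicting countable additivity.\<close>

lemma real_vector_measure_bounded:
  fixes \<nu> :: "'a::topological_space set \<Rightarrow> real"
  assumes \<nu>: "vector_measure \<nu>"
  obtains K where "\<And>B. B \<in> sets borel \<Longrightarrow> \<bar>\<nu> B\<bar> \<le> K"
proof (rule ccontr)
  define unb where "unb A \<longleftrightarrow> (\<forall>K. \<exists>B\<in>sets borel. B \<subseteq> A \<and> \<bar>\<nu> B\<bar> > K)" for A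
  assume "\<not> thesis"
  then have UNIV: "unb UNIV" unfolding unb_def using that by (meson not_le subset_UNIV)
  have step: "\<exists>Y. (Y \<in> sets borel \<and> unb Y) \<and> (Y \<subseteq> X \<and> \<bar>\<nu> (X - Y)\<bar> \<ge> 1)"
    if X: "X \<in> sets borel \<and> unb X" for X
  proof -
    \<comment> \<open>The margin makes the masses of \<open>E\<close> and of \<open>X - E\<close>
      both exceed 1 in absolute value, so either of them may be shed.\<close>
    obtain E where E: "E \<in> sets borel" "E \<subseteq> X" "\<bar>\<nu> E\<bar> > \<bar>\<nu> X\<bar> + 1"
      using X unfolding unb_def by blast
    have D: "\<nu> (X - E) = \<nu> X - \<nu> E" using vector_measure_diff[OF \<nu>] X E by blast
    show ?thesis
    proof (cases "unb E")
      case True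
      then show ?thesis using E D X by (intro exI[of _ E]) auto
    next
      case False
      then obtain K where K: "\<And>B. B \<in> sets borel \<Longrightarrow> B \<subseteq> E \<Longrightarrow> \<bar>\<nu> B\<bar> \<le> K"
        unfolding unb_def by (meson not_le)
      have "unb (X - E)" unfolding unb_def
      proof
        fix K'
        obtain B where B: "B \<in> sets borel" "B \<subseteq> X" "\<bar>\<nu> B\<bar> > K + K'"
          using X unfolding unb_def by blast
        have "\<nu> ((B \<inter> E) \<union> (B - E)) = \<nu> (B \<inter> E) + \<nu> (B - E)"
          using B E by (intro vector_measure_union[OF \<nu>]) auto
        moreover have "(B \<inter> E) \<union> (B - E) = B" by blast
        moreover have "\<bar>\<nu> (B \<inter> E)\<bar> \<le> K" using B E by (intro K) auto
        ultimately have "\<bar>\<nu> (B - E)\<bar> > K'" using B(3) by simp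
        then show "\<exists>B\<in>sets borel. B \<subseteq> X - E \<and> K' < \<bar>\<nu> B\<bar>" using B E by blast
      qed
      moreover have "X - (X - E) = E" using E by blast
      ultimately show ?thesis using E X by (intro exI[of _ "X - E"]) auto
    qed
  qed
  have "\<exists>X :: nat \<Rightarrow> 'a set. \<forall>n. (X n \<in> sets borel \<and> unb (X n)) \<and> (X (Suc n) \<subseteq> X n \<and> \<bar>\<nu> (X n - X (Suc n))\<bar> \<ge> 1)"
  proof (rule dependent_nat_choice)
    show "\<exists>X. X \<in> sets borel \<and> unb X" using UNIV by (intro exI[of _ UNIV]) simp
    show "\<exists>Y. (Y \<in> sets borel \<and> unb Y) \<and> (Y \<subseteq> X \<and> \<bar>\<nu> (X - Y)\<bar> \<ge> 1)"
      if "X \<in> sets borel \<and> unb X" for X :: "'a set" and n :: nat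
      using that by (rule step)
  qed
  then obtain X where "\<forall>n. (X n \<in> sets borel \<and> unb (X n)) \<and> (X (Suc n) \<subseteq> X n \<and> \<bar>\<nu> (X n - X (Suc n))\<bar> \<ge> 1)"
    ..
  then have X: "\<And>n. X n \<in> sets borel" "\<And>n::nat. X (Suc n) \<subseteq> X n" "\<And>n. \<bar>\<nu> (X n - X (Suc n))\<bar> \<ge> 1"
    by simp_all
  have anti: "X j \<subseteq> X i" if "i \<le> j" for i j using X(2) that by (rule lift_Suc_antimono_le)
  have "disjoint_family (\<lambda>n. X n - X (Suc n))"
    unfolding disjoint_family_on_def
  proof (intro ballI impI)
    fix i j :: nat assume "i \<noteq> j"
    then show "(X i - X (Suc i)) \<inter> (X j - X (Suc j)) = {}"
      using anti[of "Suc i" j] anti[of "Suc j" i] by (cases "i < j") (auto simp: Suc_le_eq)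
  qed
  then have "(\<lambda>n. \<nu> (X n - X (Suc n))) sums \<nu> (\<Union>n. X n - X (Suc n))"
    by (intro vector_measure_sums[OF \<nu>] sets.Diff X)
  then have "(\<lambda>n. \<nu> (X n - X (Suc n))) \<longlonglongrightarrow> 0" using summable_LIMSEQ_zero sums_summable by blast
  then have "\<forall>\<^sub>F n in sequentially. dist (\<nu> (X n - X (Suc n))) 0 < 1"
    by (rule tendstoD) simp
  then obtain n where "dist (\<nu> (X n - X (Suc n))) 0 < 1"
    using eventually_happens'[OF sequentially_bot] by blast
  then show False using X(3)[of n] by simp
qed

lemma finite_measure_positive_part:
  fixes \<nu> :: "'a::topological_space set \<Rightarrow> real"
  assumes \<nu>: "vector_measure \<nu>"
  shows "finite_measure (positive_part \<nu>)"
proof (rule finite_measureI)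
  obtain K where K: "\<And>B. B \<in> sets borel \<Longrightarrow> \<bar>\<nu> B\<bar> \<le> K" using real_vector_measure_bounded[OF \<nu>] by blast
  have U: "(UNIV :: 'a set) \<in> sets borel" by simp
  have "emeasure (positive_part \<nu>) UNIV \<le> ennreal K"
    unfolding emeasure_positive_part[OF \<nu> U]
    using K by (intro SUP_least ennreal_leI) (auto intro: order_trans[OF abs_ge_self])
  then show "emeasure (positive_part \<nu>) (space (positive_part \<nu>)) \<noteq> \<infinity>"
    by (auto simp: top_unique)
qed

text \<open>Complementation turns the values of \<nu> into those of its negative when the total mass
  is zero. Hence constants have signed integral zero.\<close>

lemma emeasure_positive_part_uminus_UNIV:
  fixes \<nu> :: "'a::topological_space set \<Rightarrow> real"
  assumes \<nu>: "vector_measure \<nu>" and 0: "\<nu> UNIV = 0"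
  shows "emeasure (positive_part (\<lambda>A. - \<nu> A)) UNIV = emeasure (positive_part \<nu>) UNIV"
proof -
  have c: "- \<nu> B = \<nu> (- B)" if "B \<in> sets borel" for B
    using vector_measure_diff[OF \<nu>, of UNIV B] that 0 by (simp add: Compl_eq_Diff_UNIV)
  have 1: "(\<lambda>B. - \<nu> B) ` sets borel = \<nu> ` sets borel"
  proof (intro equalityI subsetI)
    fix y assume "y \<in> (\<lambda>B. - \<nu> B) ` sets borel"
    then obtain B where "B \<in> sets borel" "y = - \<nu> B" by blast
    then show "y \<in> \<nu> ` sets borel" using c[of B] by (intro image_eqI[of _ _ "- B"]) auto
  next
    fix y assume "y \<in> \<nu> ` sets borel"
    then obtain B where "B \<in> sets borel" "y = \<nu> B" by blast
    then show "y \<in> (\<lambda>B. - \<nu> B) ` sets borel" using c[of "- B"]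
      by (intro image_eqI[of _ _ "- B"]) auto
  qed
  have "(SUP B\<in>sets borel. ennreal (- \<nu> B)) = (SUP y\<in>(\<lambda>B. - \<nu> B) ` sets borel. ennreal y)"
    by (simp add: image_image)
  also have "\<dots> = (SUP B\<in>sets borel. ennreal (\<nu> B))" unfolding 1 by (simp add: image_image)
  finally show ?thesis
    using emeasure_positive_part[OF \<nu>, of UNIV] emeasure_positive_part[OF vector_measure_uminus[OF \<nu>], of UNIV]
    by simp
qed

section \<open>Averages over balls\<close>

definition ball_average :: "('a::euclidean_space \<Rightarrow> real) \<Rightarrow> 'a \<Rightarrow> real \<Rightarrow> real" where
  "ball_average f p r = (LINT x:cball p r|lborel. f x) / measure lborel (cball p r)"

lemma measure_cball_pos: "r > 0 \<Longrightarrow> 0 < measure lborel (cball (p::'a::euclidean_space) r)"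
  using content_cball_pos by simp

lemma cball_set_integrable:
  fixes f :: "'a::euclidean_space \<Rightarrow> real"
  assumes "continuous_on UNIV f"
  shows "set_integrable lborel (cball p r) f"
  unfolding set_integrable_def
  by (rule borel_integrable_compact[OF compact_cball continuous_on_subset[OF assms]]) simp

lemma ball_average_const: "r > 0 \<Longrightarrow> ball_average (\<lambda>x. c) (p::'a::euclidean_space) r = c"
  using measure_cball_pos[of r p]
  unfolding ball_average_def set_lebesgue_integral_def
  by simp

lemma ball_average_add:
  assumes "continuous_on UNIV f" "continuous_on UNIV g"
  shows "ball_average (\<lambda>x. f x + g x) p r = ball_average f p r + ball_average g p r"
  unfolding ball_average_def
  using cball_set_integrable[OF assms(1)] cball_set_integrable[OF assms(2)]
  by (simp add: set_integral_add add_divide_distrib)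

lemma ball_average_cmult: "ball_average (\<lambda>x. c * f x) p r = c * ball_average f p r"
  unfolding ball_average_def by simp

lemma ball_average_sum:
  assumes "finite I" "\<And>i. i \<in> I \<Longrightarrow> continuous_on UNIV (f i)"
  shows "ball_average (\<lambda>x. \<Sum>i\<in>I. f i x) p r = (\<Sum>i\<in>I. ball_average (f i) p r)"
  using assms
proof (induction I rule: finite_induct)
  case empty
  then show ?case by (simp add: ball_average_def)
next
  case (insert i I)
  then show ?case by (simp add: ball_average_add continuous_on_sum)
qed

lemma ball_average_bound:
  fixes p :: "'a::euclidean_space"
  assumes f: "continuous_on UNIV f" and r: "r > 0"
    and K: "\<And>x. x \<in> cball p r \<Longrightarrow> \<bar>f x - c\<bar> \<le> K"
  shows "\<bar>ball_average f p r - c\<bar> \<le> K"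
proof -
  have mono: "ball_average g p r \<le> ball_average h p r"
    if "continuous_on UNIV g" "continuous_on UNIV h" "\<And>x. x \<in> cball p r \<Longrightarrow> g x \<le> h x" for g h
    unfolding ball_average_def
    using that by (intro divide_right_mono set_integral_mono cball_set_integrable) auto
  have "ball_average f p r \<le> ball_average (\<lambda>x. c + K) p r" "ball_average (\<lambda>x. c - K) p r \<le> ball_average f p r"
    using K by (force intro!: mono f continuous_intros simp: abs_le_iff)+
  then show ?thesis using r by (simp add: ball_average_const abs_le_iff)
qed

text \<open>Reflection through \<open>p\<close> preserves Lebesgue measure and the ball, and turns
  \<open>f\<close> into \<open>2 * f p - f\<close>; so the average equals \<open>2 * f p\<close>
  minus itself.\<close>

lemma ball_average_linear:
  fixes f :: "'a::euclidean_space \<Rightarrow> real"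
  assumes f: "linear f" and r: "r > 0"
  shows "ball_average f p r = f p"
proof -
  have cont: "continuous_on UNIV f" using f by (simp add: linear_continuous_on linear_linear)
  have "lborel = distr lborel borel (\<lambda>x::'a. 2 *\<^sub>R p + (- 1) *\<^sub>R x)"
    using lborel_affine[of "-1" "2 *\<^sub>R p"] by (simp add: density_1)
  then have "(LINT x:cball p r|lborel. f x) = (LINT x:cball p r|distr lborel borel (\<lambda>x. 2 *\<^sub>R p + (- 1) *\<^sub>R x). f x)"
    by simp
  also have "\<dots> = (LINT x|lborel. indicator (cball p r) (2 *\<^sub>R p + (- 1) *\<^sub>R x) *\<^sub>R f (2 *\<^sub>R p + (- 1) *\<^sub>R x))"
    unfolding set_lebesgue_integral_def
    using borel_measurable_continuous_onI[OF cont]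
    by (intro integral_distr borel_measurable_scaleR borel_measurable_indicator) auto
  also have "\<dots> = (LINT x:cball p r|lborel. 2 * f p - f x)"
    unfolding set_lebesgue_integral_def
  proof (intro Bochner_Integration.integral_cong refl)
    fix x
    have "dist p (2 *\<^sub>R p + (- 1) *\<^sub>R x) = dist p x"
      by (simp add: dist_norm norm_minus_commute scaleR_2 algebra_simps)
    moreover have "f (2 *\<^sub>R p + (- 1) *\<^sub>R x) = 2 * f p - f x"
      by (simp add: linear_add[OF f] linear_cmul[OF f] linear_diff[OF f])
    ultimately show "indicator (cball p r) (2 *\<^sub>R p + (- 1) *\<^sub>R x) *\<^sub>R f (2 *\<^sub>R p + (- 1) *\<^sub>R x)
      = indicator (cball p r) x *\<^sub>R (2 * f p - f x)"
      by (simp add: indicator_def)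
  qed
  finally have "ball_average f p r = ball_average (\<lambda>x. 2 * f p + (-1) * f x) p r"
    unfolding ball_average_def by simp
  also have "\<dots> = ball_average (\<lambda>x. 2 * f p) p r + ball_average (\<lambda>x. (-1) * f x) p r"
    by (intro ball_average_add continuous_intros cont)
  also have "\<dots> = 2 * f p - ball_average f p r"
    unfolding ball_average_const[OF r] ball_average_cmult by simp
  finally show ?thesis by simp
qed

lemma ball_average_affine:
  fixes u :: "'a::euclidean_space \<Rightarrow> 'b::euclidean_space"
  assumes "affine_map u" and r: "r > 0"
  shows "ball_average (\<lambda>x. u x \<bullet> w) p r = u p \<bullet> w"
proof -
  obtain L b where L: "linear L" and u: "\<And>x. u x = L x + b"
    using assms(1) unfolding affine_map_def by blast
  have lin: "linear (\<lambda>x. L x \<bullet> w)"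
    using L by (intro linearI) (simp_all add: linear_add linear_cmul inner_add_left)
  have "ball_average (\<lambda>x. L x \<bullet> w + b \<bullet> w) p r = L p \<bullet> w + b \<bullet> w"
    using ball_average_linear[OF lin r] r lin
    by (subst ball_average_add) (auto simp: ball_average_const linear_continuous_on linear_linear)
  then show ?thesis by (simp add: u inner_add_left)
qed

section \<open>Measures spread over balls\<close>

text \<open>A list of triples \<open>(p, r, w)\<close> stands for the sum of the Dirac masses \<open>w \<delta>\<^sub>p\<close>, each replaced by
  the uniform distribution on the ball of radius \<open>r\<close> around \<open>p\<close>.\<close>

definition smear :: "('a::euclidean_space \<times> real \<times> 'b::real_vector) list \<Rightarrow> 'a set \<Rightarrow> 'b" where
  "smear l A = (\<Sum>(p, r, w)\<leftarrow>l. (measure lborel (A \<inter> cball p r) / measure lborel (cball p r)) *\<^sub>R w)"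

definition smear_pairing :: "('a::euclidean_space \<Rightarrow> 'b::real_inner) \<Rightarrow> ('a \<times> real \<times> 'b) list \<Rightarrow> real" where
  "smear_pairing u l = (\<Sum>(p, r, w)\<leftarrow>l. ball_average (\<lambda>x. u x \<bullet> w) p r)"

definition total_weight :: "('a \<times> real \<times> 'b::monoid_add) list \<Rightarrow> 'b" where
  "total_weight l = (\<Sum>(p, r, w)\<leftarrow>l. w)"

definition positive_radii :: "('a \<times> real \<times> 'b) list \<Rightarrow> bool" where
  "positive_radii l \<longleftrightarrow> (\<forall>(p, r, w) \<in> set l. r > 0)"

lemma positive_radii_simps [simp]:
  "positive_radii []" "positive_radii ((p, r, w) # l) \<longleftrightarrow> r > 0 \<and> positive_radii l"
  "positive_radii (l @ l') \<longleftrightarrow> positive_radii l \<and> positive_radii l'"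
  unfolding positive_radii_def by (simp_all add: ball_Un)

lemma total_weight_simps [simp]:
  "total_weight [] = 0" "total_weight ((p, r, w) # l) = w + total_weight l"
  "total_weight (l @ l') = total_weight l + total_weight l'"
  unfolding total_weight_def by auto

lemma smear_simps [simp]:
  "smear [] A = 0"
  "smear ((p, r, w) # l) A =
    (measure lborel (A \<inter> cball p r) / measure lborel (cball p r)) *\<^sub>R w + smear l A"
  "smear (l @ l') A = smear l A + smear l' A"
  unfolding smear_def by auto

lemma smear_pairing_simps [simp]:
  "smear_pairing u [] = 0"
  "smear_pairing u ((p, r, w) # l) = ball_average (\<lambda>x. u x \<bullet> w) p r + smear_pairing u l"
  "smear_pairing u (l @ l') = smear_pairing u l + smear_pairing u l'"
  unfolding smear_pairing_def by auto

lemma smear_UNIV: "positive_radii l \<Longrightarrow> smear l UNIV = total_weight l"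
proof (induction l)
  case (Cons a l)
  then show ?case using measure_cball_pos[of "fst (snd a)" "fst a"] by (cases a) simp
qed simp

lemma smear_null: "A \<in> null_sets lborel \<Longrightarrow> smear l A = 0"
proof (induction l)
  case (Cons a l)
  have "A \<inter> cball p r \<in> null_sets lborel" for p :: 'a and r
    using Cons.prems by (rule null_set_Int2) simp
  then show ?case using Cons by (cases a) (simp add: null_setsD1 measure_def)
qed simp

lemma smear_vector_measure:
  fixes l :: "('a::euclidean_space \<times> real \<times> 'b::real_normed_vector) list"
  shows "vector_measure (smear l)"
  unfolding vector_measure_def
proof (intro conjI allI impI)
  show "smear l {} = 0" by (induction l) auto
  fix A :: "nat \<Rightarrow> 'a set" assume A: "range A \<subseteq> sets borel \<and> disjoint_family A"
  show "(\<lambda>i. smear l (A i)) sums smear l (\<Union>i. A i)"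
  proof (induction l)
    case (Cons a l)
    obtain p r w where a: "a = (p, r, w)" by (cases a)
    have "(\<lambda>i. measure lborel (A i \<inter> cball p r)) sums measure lborel (\<Union>i. A i \<inter> cball p r)"
    proof (rule measure_UNION)
      show "range (\<lambda>i. A i \<inter> cball p r) \<subseteq> sets lborel" using A by auto
      show "disjoint_family (\<lambda>i. A i \<inter> cball p r)" using A by (auto simp: disjoint_family_on_def)
      have "emeasure lborel (\<Union>i. A i \<inter> cball p r) \<le> emeasure lborel (cball p r)"
        by (intro emeasure_mono) auto
      then show "emeasure lborel (\<Union>i. A i \<inter> cball p r) \<noteq> \<infinity>"
        using emeasure_lborel_cball_finite[of p r] by (auto simp: top_unique)
    qed
    also have "(\<Union>i. A i \<inter> cball p r) = (\<Union>i. A i) \<inter> cball p r" by blast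
    finally show ?case unfolding a smear_simps
      by (intro sums_add sums_scaleR_left sums_divide Cons)
  qed simp
qed

lemma smear_lebesgue_ac: "lebesgue_ac (smear l)"
  unfolding lebesgue_ac_def by (simp add: smear_null)

text \<open>The bound gives finite total mass and no mass off the balls, which together make the
  first moment finite.\<close>

lemma smear_total_variation_le:
  fixes M :: "'b::euclidean_space \<Rightarrow> real"
  assumes M: "is_norm M" and A: "A \<in> sets borel"
  shows "emeasure (total_variation M (smear l)) A \<le>
    ennreal (\<Sum>(p, r, w)\<leftarrow>l. (measure lborel (A \<inter> cball p r) / measure lborel (cball p r)) * M w)"
    (is "_ \<le> ennreal (?b l A)")
proof -
  have le: "M (smear l B) \<le> ?b l B" for B
  proof (induction l)
    case (Cons a l)
    then show ?case
      by (cases a) (auto intro!: order_trans[OF is_norm_triangle[OF M]] add_mono simp: is_norm_scale[OF M])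
  qed (simp add: is_norm_zero[OF M])
  have "(\<Sum>B\<in>P. ennreal (M (smear l B))) \<le> ennreal (?b l A)"
    if P: "finite P" "P \<subseteq> sets borel" "disjoint P" "\<Union>P = A" for P
  proof -
    have "(\<Sum>B\<in>P. ?b l B) = ?b l A"
    proof (induction l)
      case (Cons a l)
      obtain p r w where a: "a = (p, r, w)" by (cases a)
      have "measure lborel (\<Union>((\<lambda>B. B \<inter> cball p r) ` P)) = (\<Sum>B\<in>P. measure lborel (B \<inter> cball p r))"
      proof (rule measure_finite_Union)
        show "(\<lambda>B. B \<inter> cball p r) ` P \<subseteq> sets lborel" using P by auto
        show "disjoint_family_on (\<lambda>B. B \<inter> cball p r) P"
          using P(3) unfolding disjoint_def disjoint_family_on_def by blast
        fix B assume "B \<in> P"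
        then have "emeasure lborel (B \<inter> cball p r) \<le> emeasure lborel (cball p r)"
          using P by (intro emeasure_mono) auto
        then show "emeasure lborel (B \<inter> cball p r) \<noteq> \<infinity>"
          using emeasure_lborel_cball_finite[of p r] by (auto simp: top_unique)
      qed (use P in simp)
      moreover have "\<Union>((\<lambda>B. B \<inter> cball p r) ` P) = A \<inter> cball p r" using P by blast
      ultimately show ?case using Cons
        by (simp add: a sum.distrib sum_divide_distrib sum_distrib_right)
    qed simp
    moreover have "(\<Sum>B\<in>P. ennreal (M (smear l B))) = ennreal (\<Sum>B\<in>P. M (smear l B))"
      by (rule sum_ennreal) (rule is_norm_nonneg[OF M])
    moreover have "(\<Sum>B\<in>P. M (smear l B)) \<le> (\<Sum>B\<in>P. ?b l B)" by (intro sum_mono le)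
    ultimately show ?thesis by (simp add: ennreal_leI)
  qed
  then show ?thesis
    unfolding emeasure_total_variation[OF M smear_vector_measure A] by (auto intro!: SUP_least)
qed

lemma smear_W1:
  fixes N :: "'a::euclidean_space \<Rightarrow> real" and M :: "'b::euclidean_space \<Rightarrow> real"
  assumes N: "is_norm N" and M: "is_norm M" and l: "positive_radii l" "total_weight l = 0"
  shows "smear l \<in> W1 N M"
  unfolding W1_def
proof (intro CollectI conjI smear_vector_measure)
  show "smear l UNIV = 0" using smear_UNIV[OF l(1)] l(2) by simp
  let ?T = "total_variation M (smear l)"
  \<comment> \<open>The total variation is carried by this compact set, on which \<open>N\<close> is
    bounded.\<close>
  let ?U = "\<Union>(p, r, w)\<in>set l. cball p r"
  have U: "compact ?U" by (intro compact_UN) auto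
  have "compact (N ` ?U)"
    by (intro compact_continuous_image U continuous_on_subset[OF is_norm_continuous[OF N]]) simp
  then obtain K where K: "\<And>x. x \<in> ?U \<Longrightarrow> N x \<le> K"
    using compact_imp_bounded[THEN bounded_imp_bdd_above] by (metis bdd_above.E image_eqI)
  have "- ?U \<in> sets borel" by (intro borel_comp borel_closed compact_imp_closed U)
  then have "emeasure ?T (- ?U) \<le> ennreal (\<Sum>(p, r, w)\<leftarrow>l. (measure lborel (- ?U \<inter> cball p r) / measure lborel (cball p r)) * M w)"
    by (rule smear_total_variation_le[OF M])
  also have "(\<Sum>(p, r, w)\<leftarrow>l. (measure lborel (- ?U \<inter> cball p r) / measure lborel (cball p r)) * M w)
    = (\<Sum>(p, r, w)\<leftarrow>l. 0)"
  proof (intro arg_cong[of _ _ sum_list] map_cong refl)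
    fix a assume "a \<in> set l"
    moreover obtain p r w where a: "a = (p, r, w)" by (cases a)
    ultimately have "- ?U \<inter> cball p r = {}" by force
    then show "(case a of (p, r, w) \<Rightarrow> (measure lborel (- ?U \<inter> cball p r) / measure lborel (cball p r)) * M w) = (case a of (p, r, w) \<Rightarrow> 0)"
      using a by simp
  qed
  finally have "emeasure ?T (- ?U) = 0" by (simp add: case_prod_unfold)
  then have "- ?U \<in> null_sets ?T" using \<open>- ?U \<in> sets borel\<close> by (simp add: null_sets_def)
  then have "AE x in ?T. x \<in> ?U" by (rule AE_I') auto
  then have "(\<integral>\<^sup>+x. ennreal (N (x - 0)) \<partial>?T) \<le> (\<integral>\<^sup>+x. ennreal K \<partial>?T)"
    by (intro nn_integral_mono_AE) (auto elim!: eventually_mono intro!: ennreal_leI K)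
  also have "\<dots> < \<infinity>"
    using order.strict_trans1[OF smear_total_variation_le[OF M, of UNIV l] ennreal_less_top]
    by (simp add: ennreal_mult_less_top)
  finally show "\<exists>x0. (\<integral>\<^sup>+x. ennreal (N (x - x0)) \<partial>?T) < \<infinity>" by blast
qed

section \<open>Integration against vector measures\<close>

lemma positive_part_density:
  fixes g :: "'a::euclidean_space \<Rightarrow> real"
  assumes \<nu>: "vector_measure \<nu>" and g: "integrable lborel g"
    and eq: "\<And>A. A \<in> sets borel \<Longrightarrow> \<nu> A = (LINT x:A|lborel. g x)"
  shows "positive_part \<nu> = density lborel (\<lambda>x. ennreal (max 0 (g x)))"
proof (rule measure_eqI)
  have [measurable]: "g \<in> borel_measurable borel" using g by auto
  fix A assume "A \<in> sets (positive_part \<nu>)"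
  then have A [measurable]: "A \<in> sets borel" by simp
  have int: "set_integrable lborel B g" if "B \<in> sets borel" for B
    using integrable_mult_indicator[of B lborel g] that g unfolding set_integrable_def by simp
  show "emeasure (positive_part \<nu>) A = emeasure (density lborel (\<lambda>x. ennreal (max 0 (g x)))) A"
    unfolding emeasure_positive_part[OF \<nu> A]
  proof (rule antisym)
    show "(SUP B \<in> {B \<in> sets borel. B \<subseteq> A}. ennreal (\<nu> B)) \<le> emeasure (density lborel (\<lambda>x. ennreal (max 0 (g x)))) A"
    proof (rule SUP_least)
      fix B assume B: "B \<in> {B \<in> sets borel. B \<subseteq> A}"
      then have [measurable]: "B \<in> sets borel" by simp
      have "ennreal (\<nu> B) \<le> ennreal (LINT x|lborel. indicator B x * max 0 (g x))"
        using int[of B] B integrable_mult_indicator[of B lborel "\<lambda>x. max 0 (g x)"] g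
        unfolding eq[OF \<open>B \<in> sets borel\<close>] set_lebesgue_integral_def set_integrable_def
        by (intro ennreal_leI integral_mono) (auto simp: indicator_def)
      also have "\<dots> = (\<integral>\<^sup>+x. ennreal (indicator B x * max 0 (g x)) \<partial>lborel)"
        using integrable_mult_indicator[of B lborel "\<lambda>x. max 0 (g x)"] g
        by (intro nn_integral_eq_integral[symmetric]) auto
      also have "\<dots> \<le> (\<integral>\<^sup>+x. ennreal (max 0 (g x)) * indicator A x \<partial>lborel)"
        using B by (intro nn_integral_mono) (auto simp: indicator_def)
      also have "\<dots> = emeasure (density lborel (\<lambda>x. ennreal (max 0 (g x)))) A"
        by (subst emeasure_density) auto
      finally show "ennreal (\<nu> B) \<le> emeasure (density lborel (\<lambda>x. ennreal (max 0 (g x)))) A" .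
    qed
    \<comment> \<open>Inside \<open>A\<close> this is the positive set of a Hahn decomposition, so
      the supremum is attained there.\<close>
    define B where "B = A \<inter> {x. 0 \<le> g x}"
    have B [measurable]: "B \<in> sets borel" unfolding B_def by measurable
    have "emeasure (density lborel (\<lambda>x. ennreal (max 0 (g x)))) A = (\<integral>\<^sup>+x. ennreal (max 0 (g x)) * indicator A x \<partial>lborel)"
      by (subst emeasure_density) auto
    also have "\<dots> = (\<integral>\<^sup>+x. ennreal (indicator B x * g x) \<partial>lborel)"
      by (intro nn_integral_cong) (auto simp: indicator_def B_def)
    also have "\<dots> = ennreal (LINT x:B|lborel. g x)"
      using int[OF B] unfolding set_lebesgue_integral_def set_integrable_def
      by (subst nn_integral_eq_integral) (auto simp: B_def indicator_def)
    also have "\<dots> \<le> (SUP B \<in> {B \<in> sets borel. B \<subseteq> A}. ennreal (\<nu> B))"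
      using B by (intro SUP_upper2[of B]) (auto simp: eq B_def)
    finally show "emeasure (density lborel (\<lambda>x. ennreal (max 0 (g x)))) A \<le> (SUP B \<in> {B \<in> sets borel. B \<subseteq> A}. ennreal (\<nu> B))" .
  qed
qed simp

lemma signed_integral_density:
  fixes g :: "'a::euclidean_space \<Rightarrow> real"
  assumes \<nu>: "vector_measure \<nu>" and g: "integrable lborel g"
    and eq: "\<And>A. A \<in> sets borel \<Longrightarrow> \<nu> A = (LINT x:A|lborel. g x)"
    and f: "f \<in> borel_measurable borel" and fg: "integrable lborel (\<lambda>x. g x * f x)"
  shows "signed_integral f \<nu> = (LINT x|lborel. g x * f x)"
proof -
  have [measurable]: "g \<in> borel_measurable borel" using g by auto
  note [measurable] = f
  have i: "integrable lborel (\<lambda>x. max 0 (g x) * f x)" "integrable lborel (\<lambda>x. max 0 (- g x) * f x)"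
    by (rule Bochner_Integration.integrable_bound[OF fg]; simp add: abs_mult mult_right_mono)+
  have 1: "(LINT x|positive_part \<nu>. f x) = (LINT x|lborel. max 0 (g x) * f x)"
    by (subst positive_part_density[OF \<nu> g]) (auto simp: eq integral_density)
  have "- \<nu> A = (LINT x:A|lborel. - g x)" if "A \<in> sets borel" for A
    by (simp add: eq[OF that] set_lebesgue_integral_def)
  then have 2: "(LINT x|positive_part (\<lambda>A. - \<nu> A). f x) = (LINT x|lborel. max 0 (- g x) * f x)"
    using positive_part_density[OF vector_measure_uminus[OF \<nu>], of "\<lambda>x. - g x"] g
    by (simp, subst integral_density) auto
  have "signed_integral f \<nu> = (LINT x|lborel. max 0 (g x) * f x - max 0 (- g x) * f x)"
    unfolding signed_integral_def 1 2 using i by simp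
  also have "\<dots> = (LINT x|lborel. g x * f x)"
    by (intro Bochner_Integration.integral_cong refl) (auto simp: max_def algebra_simps)
  finally show ?thesis .
qed

text \<open>This leads from Jordan decompositions to ball averages, the form in which all estimates
  are made. Balls may overlap with cancelling weights, because the Jordan parts are computed from
  the summed density.\<close>

lemma vector_integral_smear:
  fixes u :: "real ^ 'n \<Rightarrow> real ^ 'm"
  assumes u: "continuous_on UNIV u" and l: "positive_radii l"
  shows "vector_integral u (smear l) = smear_pairing u l"
proof -
  have ui: "continuous_on UNIV (\<lambda>x. u x $ i)" for i using u by (intro continuous_intros)
  \<comment> \<open>\<open>g i\<close> is the density of the component \<open>i\<close> of
    \<open>smear l\<close>. The fact \<open>int\<close> below is proved for all functions integrable
    on balls, and is used for the constant 1, for indicators and for the components of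
    \<open>u\<close>.\<close>
  define g where "g i x = (\<Sum>(p, r, w)\<leftarrow>l. (w $ i / measure lborel (cball p r)) * indicator (cball p r) x)"
    for i and x :: "real ^ 'n"
  have si: "signed_integral (\<lambda>x. u x $ i) (\<lambda>A. smear l A $ i) =
      (\<Sum>(p, r, w)\<leftarrow>l. w $ i * ball_average (\<lambda>x. u x $ i) p r)" for i
  proof -
    have int: "integrable lborel (\<lambda>x. g i x * f x) \<and>
        (LINT x|lborel. g i x * f x) = (\<Sum>(p, r, w)\<leftarrow>l. w $ i * ball_average f p r)"
      if f: "\<And>p r. set_integrable lborel (cball p r) f" for f
      unfolding g_def
    proof (induction l)
      case (Cons a l)
      obtain p r w where a: "a = (p, r, w)" by (cases a)
      have c: "integrable lborel (\<lambda>x. (w $ i / measure lborel (cball p r)) * (indicator (cball p r) x * f x))"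
        using f[of p r] unfolding set_integrable_def by simp
      have "(LINT x|lborel. (w $ i / measure lborel (cball p r)) * (indicator (cball p r) x * f x)) =
          w $ i * ball_average f p r"
        unfolding ball_average_def set_lebesgue_integral_def by simp
      then show ?case using Cons c
        by (simp add: a distrib_right mult.assoc Bochner_Integration.integral_add del: Bochner_Integration.integral_mult_right_zero)
    qed simp
    have "integrable lborel (g i)"
      using conjunct1[OF int[OF cball_set_integrable[OF continuous_on_const[of _ 1]]]] by simp
    moreover have "smear l A $ i = (LINT x:A|lborel. g i x)" if A: "A \<in> sets borel" for A
    proof -
      have "(LINT x:A|lborel. g i x) = (LINT x|lborel. g i x * indicator A x)"
        unfolding set_lebesgue_integral_def by (simp add: mult.commute)
      also have "\<dots> = (\<Sum>(p, r, w)\<leftarrow>l. w $ i * ball_average (indicator A) p r)"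
      proof (intro conjunct2[OF int])
        fix p r
        have "integrable lborel (indicator (A \<inter> cball p r) :: _ \<Rightarrow> real)"
          using A emeasure_mono[of "A \<inter> cball p r" "cball p r" lborel] emeasure_lborel_cball_finite[of p r]
          by (intro integrable_real_indicator) auto
        moreover have "(\<lambda>x. indicator (cball p r) x *\<^sub>R indicator A x :: real) = indicator (A \<inter> cball p r)"
          by (auto simp: indicator_def fun_eq_iff)
        ultimately show "set_integrable lborel (cball p r) (indicator A :: _ \<Rightarrow> real)"
          unfolding set_integrable_def by simp
      qed
      also have "\<dots> = smear l A $ i"
      proof (induction l)
        case (Cons a l)
        obtain p r w where a: "a = (p, r, w)" by (cases a)
        have "(LINT x:cball p r|lborel. indicator A x) = measure lborel (A \<inter> cball p r)"
        proof -
          have "(LINT x:cball p r|lborel. indicator A x :: real) = (LINT x|lborel. indicator (A \<inter> cball p r) x)"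
            unfolding set_lebesgue_integral_def by (simp add: indicator_inter_arith mult.commute)
          then show ?thesis using A by simp
        qed
        then show ?case using Cons by (simp add: a ball_average_def)
      qed simp
      finally show ?thesis by simp
    qed
    ultimately have "signed_integral (\<lambda>x. u x $ i) (\<lambda>A. smear l A $ i) = (LINT x|lborel. g i x * u x $ i)"
      using int[of "\<lambda>x. u x $ i"] cball_set_integrable[OF ui]
      by (intro signed_integral_density vector_measure_component smear_vector_measure
          borel_measurable_continuous_onI ui) auto
    also have "\<dots> = (\<Sum>(p, r, w)\<leftarrow>l. w $ i * ball_average (\<lambda>x. u x $ i) p r)"
      using int[of "\<lambda>x. u x $ i"] cball_set_integrable[OF ui] by blast
    finally show ?thesis .
  qed
  have "vector_integral u (smear l) = (\<Sum>i\<in>UNIV. \<Sum>(p, r, w)\<leftarrow>l. w $ i * ball_average (\<lambda>x. u x $ i) p r)"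
    unfolding vector_integral_def si ..
  also have "\<dots> = smear_pairing u l"
  proof (induction l)
    case (Cons a l)
    obtain p r w where a: "a = (p, r, w)" by (cases a)
    have "ball_average (\<lambda>x. u x \<bullet> w) p r = (\<Sum>i\<in>UNIV. w $ i * ball_average (\<lambda>x. u x $ i) p r)"
      unfolding inner_vec_def
      by (subst ball_average_sum) (auto intro!: continuous_intros ui simp: mult.commute ball_average_cmult)
    then show ?case using Cons by (simp add: a sum.distrib)
  qed simp
  finally show ?thesis .
qed

section \<open>Existence of optimal potentials\<close>

lemma optimal_potential_iff:
  "optimal_potential F \<mu> u0 \<longleftrightarrow> u0 \<in> F \<and> (\<forall>u\<in>F. vector_integral u \<mu> \<le> vector_integral u0 \<mu>)"
proof -
  have "ereal (vector_integral u0 \<mu>) = (SUP u\<in>F. ereal (vector_integral u \<mu>)) \<longleftrightarrow>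
      (\<forall>u\<in>F. vector_integral u \<mu> \<le> vector_integral u0 \<mu>)" if "u0 \<in> F"
  proof
    assume eq: "ereal (vector_integral u0 \<mu>) = (SUP u\<in>F. ereal (vector_integral u \<mu>))"
    show "\<forall>u\<in>F. vector_integral u \<mu> \<le> vector_integral u0 \<mu>"
    proof
      fix u assume "u \<in> F"
      then have "ereal (vector_integral u \<mu>) \<le> (SUP u\<in>F. ereal (vector_integral u \<mu>))" by (rule SUP_upper)
      then show "vector_integral u \<mu> \<le> vector_integral u0 \<mu>" unfolding eq[symmetric] by simp
    qed
  next
    assume "\<forall>u\<in>F. vector_integral u \<mu> \<le> vector_integral u0 \<mu>"
    then show "ereal (vector_integral u0 \<mu>) = (SUP u\<in>F. ereal (vector_integral u \<mu>))"
      using that by (intro antisym SUP_upper SUP_least) auto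
  qed
  then show ?thesis unfolding optimal_potential_def by blast
qed

section \<open>Compactness of equi-Lipschitz families\<close>

lemma pointwise_uniform_limit_of_lipschitz:
  fixes f :: "nat \<Rightarrow> 'a::euclidean_space \<Rightarrow> 'b::euclidean_space"
  assumes C: "C > 0" and lip: "\<And>k x y. norm (f k x - f k y) \<le> C * norm (x - y)"
    and lim: "\<And>x. (\<lambda>k. f k x) \<longlonglongrightarrow> g x" and K: "compact K"
  shows "uniform_limit K f g sequentially"
proof (rule uniform_limitI)
  fix e :: real assume e: "e > 0"
  have glip: "norm (g x - g y) \<le> C * norm (x - y)" for x y
    by (intro Lim_bounded[OF tendsto_norm[OF tendsto_diff[OF lim lim]]]) (auto intro: lip)
  \<comment> \<open>On a ball of radius \<open>d\<close> the maps \<open>f k\<close> and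
    \<open>g\<close> vary by at most \<open>e / 3\<close> each, which leaves \<open>e / 3\<close>
    for convergence on a finite net.\<close>
  define d where "d = e / (3 * C)"
  have d: "d > 0" "C * d = e / 3" using e C by (auto simp: d_def)
  obtain T where T: "finite T" "K \<subseteq> (\<Union>t\<in>T. ball t d)"
    using K d(1) unfolding compact_eq_totally_bounded by blast
  have "\<forall>\<^sub>F k in sequentially. \<forall>t\<in>T. dist (f k t) (g t) < e / 3"
    using T(1) e by (intro eventually_ball_finite ballI tendstoD[OF lim]) auto
  then show "\<forall>\<^sub>F k in sequentially. \<forall>x\<in>K. dist (f k x) (g x) < e"
  proof (rule eventually_mono)
    fix k assume k: "\<forall>t\<in>T. dist (f k t) (g t) < e / 3"
    show "\<forall>x\<in>K. dist (f k x) (g x) < e"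
    proof
      fix x assume "x \<in> K"
      then obtain t where t: "t \<in> T" "norm (x - t) < d" using T(2) by (force simp: dist_norm norm_minus_commute)
      have "norm (f k x - f k t) \<le> e / 3" "norm (g x - g t) \<le> e / 3"
        using lip[of k x t] glip[of x t] t(2) C d mult_left_mono[of "norm (x - t)" d C] by linarith+
      moreover have "norm (f k t - g t) < e / 3" using k t by (simp add: dist_norm)
      moreover have "norm (f k x - g x) \<le> norm (f k x - f k t) + norm (f k t - g t) + norm (g x - g t)"
        using norm_triangle_le_diff[OF add_right_mono[OF norm_triangle_ineq[of "f k x - f k t" "f k t - g t"]],
            of "g x - g t"] by simp
      ultimately show "dist (f k x) (g x) < e"
        unfolding dist_norm by linarith
    qed
  qed
qed

lemma lipschitz_convergent_subsequence:
  fixes f :: "nat \<Rightarrow> 'a::euclidean_space \<Rightarrow> 'b::euclidean_space"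
  assumes C: "C > 0" and lip: "\<And>k x y. norm (f k x - f k y) \<le> C * norm (x - y)"
    and f0: "\<And>k. f k 0 = 0"
  obtains g s where "strict_mono (s :: nat \<Rightarrow> nat)"
    "\<And>K. compact K \<Longrightarrow> uniform_limit K (\<lambda>k. f (s k)) g sequentially"
proof -
  obtain D :: "'a set" where D: "countable D" "\<And>X. open X \<Longrightarrow> X \<noteq> {} \<Longrightarrow> \<exists>d\<in>D. d \<in> X"
    using countable_dense_exists[where 'a = 'a] by auto
  \<comment> \<open>The diagonal argument takes one bound for all points. Maps vanishing at 0 grow
    at most linearly, so division by \<open>1 + norm x\<close> provides it.\<close>
  have "norm ((1 / (1 + norm x)) *\<^sub>R f k x) \<le> C" for k x
  proof -
    have pos: "1 + norm x > 0" using norm_ge_zero[of x] by linarith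
    have "norm (f k x) \<le> C * norm x" using lip[of k x 0] f0 by simp
    also have "\<dots> \<le> C * (1 + norm x)" using C by simp
    finally have "norm (f k x) / (1 + norm x) \<le> C" using pos by (simp add: pos_divide_le_eq)
    then show ?thesis using pos by simp
  qed
  then obtain s where s: "strict_mono (s :: nat \<Rightarrow> nat)"
    and conv: "\<And>x. x \<in> D \<Longrightarrow> \<exists>l. (\<lambda>k. (1 / (1 + norm x)) *\<^sub>R f (s k) x) \<longlonglongrightarrow> l"
    using function_convergent_subsequence[OF D(1), of "\<lambda>k x. (1 / (1 + norm x)) *\<^sub>R f k x" C] by metis
  have convD: "Cauchy (\<lambda>k. f (s k) x)" if x: "x \<in> D" for x
  proof -
    obtain l where "(\<lambda>k. (1 / (1 + norm x)) *\<^sub>R f (s k) x) \<longlonglongrightarrow> l" using conv[OF x] by blast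
    then have "(\<lambda>k. (1 + norm x) *\<^sub>R ((1 / (1 + norm x)) *\<^sub>R f (s k) x)) \<longlonglongrightarrow> (1 + norm x) *\<^sub>R l"
      by (intro tendsto_intros)
    moreover have "1 + norm x \<noteq> 0" using norm_ge_zero[of x] by linarith
    ultimately show ?thesis by (intro LIMSEQ_imp_Cauchy) simp
  qed
  \<comment> \<open>Equicontinuity carries the Cauchy property over from a nearby point of the dense
    set \<open>D\<close>, at the cost of three errors of size \<open>e / 3\<close>.\<close>
  have "convergent (\<lambda>k. f (s k) x)" for x
  proof (rule Cauchy_convergent, rule CauchyI)
    fix e :: real assume e: "e > 0"
    have "e / (3 * C) > 0" using e C by simp
    then have "x \<in> ball x (e / (3 * C))" by simp
    then obtain d where d: "d \<in> D" "dist x d < e / (3 * C)"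
      using D(2)[of "ball x (e / (3 * C))"] by fastforce
    have close: "norm (f (s k) x - f (s k) d) < e / 3" for k
    proof -
      have "norm (f (s k) x - f (s k) d) \<le> C * norm (x - d)" by (rule lip)
      also have "\<dots> < C * (e / (3 * C))"
        using d(2) C by (intro mult_strict_left_mono) (auto simp: dist_norm)
      finally show ?thesis using C by simp
    qed
    obtain n0 where n0: "\<And>m n. m \<ge> n0 \<Longrightarrow> n \<ge> n0 \<Longrightarrow> norm (f (s m) d - f (s n) d) < e / 3"
      using CauchyD[OF convD[OF d(1)], of "e / 3"] e by auto
    have "norm (f (s m) x - f (s n) x) < e" if "m \<ge> n0" "n \<ge> n0" for m n
    proof -
      have "norm (f (s m) x - f (s n) x) \<le>
          norm (f (s m) x - f (s m) d) + norm (f (s m) d - f (s n) d) + norm (f (s n) x - f (s n) d)"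
        using norm_triangle_le_diff[OF add_right_mono[OF norm_triangle_ineq[of "f (s m) x - f (s m) d" "f (s m) d - f (s n) d"]],
            of "f (s n) x - f (s n) d"] by simp
      then show ?thesis using close[of m] close[of n] n0[OF that] by linarith
    qed
    then show "\<exists>M. \<forall>m\<ge>M. \<forall>n\<ge>M. norm (f (s m) x - f (s n) x) < e" by blast
  qed
  then have lim: "(\<lambda>k. f (s k) x) \<longlonglongrightarrow> lim (\<lambda>k. f (s k) x)" for x
    by (simp add: convergent_LIMSEQ_iff)
  show ?thesis
    by (rule that[OF s pointwise_uniform_limit_of_lipschitz[OF C _ lim]]) (rule lip)
qed

text \<open>For total weight zero the pairing is blind to constants, in accordance with
  \<open>up_to_constants\<close>.\<close>

lemma smear_pairing_add_const:
  assumes u: "continuous_on UNIV u" and l: "positive_radii l"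
  shows "smear_pairing (\<lambda>x. u x + c) l = smear_pairing u l + c \<bullet> total_weight l"
  using l
proof (induction l)
  case (Cons a l)
  obtain p r w where a: "a = (p, r, w)" by (cases a)
  have "ball_average (\<lambda>x. (u x + c) \<bullet> w) p r = ball_average (\<lambda>x. u x \<bullet> w) p r + c \<bullet> w"
    unfolding inner_add_left using Cons.prems
    by (subst ball_average_add) (auto intro!: continuous_intros u simp: a ball_average_const)
  then show ?case using Cons by (simp add: a inner_add_right)
qed simp

lemma smear_pairing_diff_bound:
  fixes u v :: "'a::euclidean_space \<Rightarrow> 'b::euclidean_space"
  assumes u: "continuous_on UNIV u" and v: "continuous_on UNIV v" and l: "positive_radii l"
    and K: "\<And>p r w x. (p, r, w) \<in> set l \<Longrightarrow> x \<in> cball p r \<Longrightarrow> norm (u x - v x) \<le> K"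
  shows "\<bar>smear_pairing u l - smear_pairing v l\<bar> \<le> K * (\<Sum>(p, r, w)\<leftarrow>l. norm w)"
  using l K
proof (induction l)
  case (Cons a l)
  obtain p r w where a: "a = (p, r, w)" by (cases a)
  have r: "r > 0" using Cons.prems a by simp
  have "ball_average (\<lambda>x. u x \<bullet> w) p r = ball_average (\<lambda>x. (u x - v x) \<bullet> w + v x \<bullet> w) p r"
    by (simp add: inner_diff_left)
  also have "\<dots> = ball_average (\<lambda>x. (u x - v x) \<bullet> w) p r + ball_average (\<lambda>x. v x \<bullet> w) p r"
    by (intro ball_average_add continuous_intros u v)
  finally have eq: "ball_average (\<lambda>x. u x \<bullet> w) p r - ball_average (\<lambda>x. v x \<bullet> w) p r =
    ball_average (\<lambda>x. (u x - v x) \<bullet> w) p r" by simp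
  have "\<bar>ball_average (\<lambda>x. (u x - v x) \<bullet> w) p r - 0\<bar> \<le> K * norm w"
  proof (intro ball_average_bound r continuous_intros u v)
    fix x assume "x \<in> cball p r"
    then have "norm (u x - v x) \<le> K" using Cons.prems(2)[of p r w x] a by simp
    then show "\<bar>(u x - v x) \<bullet> w - 0\<bar> \<le> K * norm w"
      using Cauchy_Schwarz_ineq2[of "u x - v x" w] mult_right_mono[of "norm (u x - v x)" K "norm w"] by simp
  qed
  moreover have "\<bar>smear_pairing u l - smear_pairing v l\<bar> \<le> K * (\<Sum>(p, r, w)\<leftarrow>l. norm w)"
    using Cons by (auto simp: a)
  ultimately show ?case using eq by (simp add: a algebra_simps)
qed simp

text \<open>The direct method: a maximising sequence, shifted to vanish at 0 without change of the
  pairing, has a locally uniformly convergent subsequence. Its limit lies in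
  \<open>up_to_constants F\<close>, and removing the constant yields a maximiser in
  \<open>F\<close>.\<close>

lemma optimal_potential_exists:
  fixes N :: "real ^ 'n \<Rightarrow> real" and M :: "real ^ 'm \<Rightarrow> real"
  assumes N: "is_norm N" and M: "is_norm M" and ne: "F \<noteq> {}"
    and lip: "\<forall>u\<in>F. one_lipschitz N M u"
    and closed: "locally_uniformly_closed (up_to_constants F)"
    and l: "positive_radii l" "total_weight l = 0"
  obtains u0 where "u0 \<in> F" "\<And>u. u \<in> F \<Longrightarrow> smear_pairing u l \<le> smear_pairing u0 l"
    "optimal_potential F (smear l) u0"
proof -
  have contF: "continuous_on UNIV u" if "u \<in> F" for u
    using one_lipschitz_continuous[OF N M] lip that by blast
  obtain C where C: "C > 0" "\<And>u x y. u \<in> F \<Longrightarrow> norm (u x - u y) \<le> C * norm (x - y)"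
    using one_lipschitz_bound[OF N M] lip by metis
  \<comment> \<open>A crude radius of a ball around 0 containing all balls of \<open>l\<close>;
    uniform convergence on it controls the pairing.\<close>
  define R where "R = (\<Sum>(p, r, w)\<leftarrow>l. norm p + r)"
  have R: "norm x \<le> R" if "(p, r, w) \<in> set l" "x \<in> cball p r" for p r w x
  proof -
    have "norm x \<le> norm p + r" using that(2) norm_triangle_ineq2[of x p] by (simp add: dist_norm norm_minus_commute)
    also have "\<dots> \<le> R" unfolding R_def
    proof (rule member_le_sum_list)
      show "norm p + r \<in> set (map (\<lambda>(p, r, w). norm p + r) l)" using that(1) by force
      show "\<And>y. y \<in> set (map (\<lambda>(p, r, w). norm p + r) l) \<Longrightarrow> 0 \<le> y"
        using l(1) unfolding positive_radii_def by force
    qed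
    finally show ?thesis .
  qed
  define W where "W = (\<Sum>(p, r, w)\<leftarrow>l. norm w)"
  define v where "v u x = u x + - u 0" for u :: "real ^ 'n \<Rightarrow> real ^ 'm" and x
  have v: "smear_pairing (v u) l = smear_pairing u l" if "u \<in> F" for u
    unfolding v_def using smear_pairing_add_const[OF contF[OF that] l(1), of "- u 0"] l(2) by simp
  have bound: "smear_pairing u l \<le> (C * R) * W" if u: "u \<in> F" for u
  proof -
    have "\<bar>smear_pairing (v u) l - smear_pairing (\<lambda>x. 0) l\<bar> \<le> (C * R) * W"
      unfolding W_def
    proof (rule smear_pairing_diff_bound)
      show "continuous_on UNIV (v u)" unfolding v_def by (intro continuous_intros contF u)
      fix p r w x assume "(p, r, w) \<in> set l" "x \<in> cball p r"
      then have "C * norm x \<le> C * R" using R C by simp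
      then show "norm (v u x - 0) \<le> C * R"
        using C(2)[OF u, of x 0] by (simp add: v_def)
    qed (use l in auto)
    moreover have "smear_pairing (\<lambda>x. 0) l = 0"
      by (induction l) (auto simp: ball_average_def)
    ultimately show ?thesis using v[OF u] by simp
  qed
  define S where "S = (SUP u\<in>F. smear_pairing u l)"
  have bdd: "bdd_above ((\<lambda>u. smear_pairing u l) ` F)" using bound by (auto intro!: bdd_aboveI2)
  have "\<exists>u\<in>F. S - 1 / Suc k < smear_pairing u l" for k
    using less_cSUP_iff[OF ne bdd, of "S - 1 / Suc k"] unfolding S_def by simp
  then obtain f where f: "\<And>k. f k \<in> F" "\<And>k. S - 1 / Suc k < smear_pairing (f k) l" by metis
  obtain g s where s: "strict_mono (s :: nat \<Rightarrow> nat)"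
    and g: "\<And>K. compact K \<Longrightarrow> uniform_limit K (\<lambda>k. v (f (s k))) g sequentially"
  proof (rule lipschitz_convergent_subsequence[OF C(1), of "\<lambda>k. v (f k)"])
    show "norm (v (f k) x - v (f k) y) \<le> C * norm (x - y)" for k x y
      using C(2)[OF f(1)] by (simp add: v_def)
  qed (auto simp: v_def)
  have "v (f (s k)) \<in> up_to_constants F" for k
    unfolding up_to_constants_def v_def
    using f(1) by (intro CollectI exI[of _ "f (s k)"] exI[of _ "- f (s k) 0"]) simp
  then have "g \<in> up_to_constants F"
    using closed[unfolded locally_uniformly_closed_def, rule_format, of "\<lambda>k. v (f (s k))" g] g by simp
  then obtain u c where u: "u \<in> F" and gu: "g = (\<lambda>x. u x + c)" unfolding up_to_constants_def by blast
  have contg: "continuous_on UNIV g" unfolding gu by (intro continuous_intros contF u)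
  have pg: "smear_pairing g l = smear_pairing u l"
    unfolding gu using smear_pairing_add_const[OF contF[OF u] l(1)] l(2) by simp
  have "(\<lambda>k. smear_pairing (v (f (s k))) l) \<longlonglongrightarrow> smear_pairing g l"
  proof (rule tendstoI)
    fix e :: real assume e: "e > 0"
    have W: "W \<ge> 0" unfolding W_def by (auto intro!: sum_list_nonneg)
    then have "e / (W + 1) > 0" using e by simp
    from uniform_limitD[OF g[OF compact_cball] this]
    have "\<forall>\<^sub>F k in sequentially. \<forall>x\<in>cball 0 R. dist (v (f (s k)) x) (g x) < e / (W + 1)" .
    then show "\<forall>\<^sub>F k in sequentially. dist (smear_pairing (v (f (s k))) l) (smear_pairing g l) < e"
    proof (rule eventually_mono)
      fix k assume k: "\<forall>x\<in>cball 0 R. dist (v (f (s k)) x) (g x) < e / (W + 1)"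
      have "\<bar>smear_pairing (v (f (s k))) l - smear_pairing g l\<bar> \<le> (e / (W + 1)) * W"
        unfolding W_def
      proof (rule smear_pairing_diff_bound[OF _ contg l(1)])
        show "continuous_on UNIV (v (f (s k)))" unfolding v_def by (intro continuous_intros contF f)
        show "norm (v (f (s k)) x - g x) \<le> e / ((\<Sum>(p, r, w)\<leftarrow>l. norm w) + 1)"
          if "(p, r, w) \<in> set l" "x \<in> cball p r" for p r w x
          using k R[OF that] unfolding W_def by (auto simp: dist_norm intro: less_imp_le)
      qed
      also have "\<dots> < e" using e W by (simp add: field_simps)
      finally show "dist (smear_pairing (v (f (s k))) l) (smear_pairing g l) < e" by (simp add: dist_real_def)
    qed
  qed
  moreover have "(\<lambda>k. S - 1 / real (Suc (s k))) \<longlonglongrightarrow> S - 0"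
    using LIMSEQ_subseq_LIMSEQ[OF LIMSEQ_Suc[OF lim_1_over_n] s] unfolding o_def
    by (intro tendsto_intros) simp
  ultimately have "S - 0 \<le> smear_pairing g l"
    using f(2) by (intro LIMSEQ_le) (auto simp: v[OF f(1)] less_imp_le)
  then have opt: "smear_pairing u' l \<le> smear_pairing u l" if "u' \<in> F" for u'
    using cSUP_upper[OF that bdd] unfolding S_def pg by simp
  then have "optimal_potential F (smear l) u"
    unfolding optimal_potential_iff using u contF by (simp add: vector_integral_smear l)
  then show ?thesis using that[OF u opt] by blast
qed

section \<open>Balance along a subspace\<close>

lemma orthogonal_projection:
  fixes S :: "'a::euclidean_space set"
  assumes S: "subspace S"
  shows "orthogonal_projection S x \<in> S" "\<And>s. s \<in> S \<Longrightarrow> orthogonal (x - orthogonal_projection S x) s"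
    and "\<And>y. y \<in> S \<Longrightarrow> (\<And>s. s \<in> S \<Longrightarrow> orthogonal (x - y) s) \<Longrightarrow> orthogonal_projection S x = y"
proof -
  have "x \<in> S + S\<^sup>\<bottom>" using subspace_sum_orthogonal_comp[OF S] by simp
  then obtain y z where y: "y \<in> S" and z: "z \<in> S\<^sup>\<bottom>" and x: "x = y + z" by (rule set_plus_elim)
  have "orthogonal (x - y) s" if "s \<in> S" for s
    using z that unfolding x orthogonal_comp_def by (simp add: orthogonal_commute)
  then have ex: "y \<in> S \<and> (\<forall>s\<in>S. orthogonal (x - y) s)" using y by blast
  have uniq: "y' = y''" if *: "y' \<in> S \<and> (\<forall>s\<in>S. orthogonal (x - y') s)" "y'' \<in> S \<and> (\<forall>s\<in>S. orthogonal (x - y'') s)" for y' y''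
  proof -
    have "y' - y'' \<in> S" using * subspace_diff[OF S] by blast
    then have "(x - y'') \<bullet> (y' - y'') = 0" "(x - y') \<bullet> (y' - y'') = 0"
      using * unfolding orthogonal_def by blast+
    then have "(y' - y'') \<bullet> (y' - y'') = 0" by (simp add: inner_diff_left)
    then show ?thesis by simp
  qed
  have "orthogonal_projection S x \<in> S \<and> (\<forall>s\<in>S. orthogonal (x - orthogonal_projection S x) s)"
    unfolding orthogonal_projection_def by (rule theI[of _ y]) (use ex uniq in blast)+
  then show "orthogonal_projection S x \<in> S" "\<And>s. s \<in> S \<Longrightarrow> orthogonal (x - orthogonal_projection S x) s"
    and "\<And>y. y \<in> S \<Longrightarrow> (\<And>s. s \<in> S \<Longrightarrow> orthogonal (x - y) s) \<Longrightarrow> orthogonal_projection S x = y"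
    using uniq by blast+
qed

lemma linear_orthogonal_projection:
  fixes S :: "'a::euclidean_space set"
  assumes S: "subspace S"
  shows "linear (orthogonal_projection S)"
proof (rule linearI)
  note P = orthogonal_projection[OF S]
  let ?P = "orthogonal_projection S"
  show "?P (x + y) = ?P x + ?P y" for x y
  proof (rule P(3))
    show "?P x + ?P y \<in> S" by (intro subspace_add S P)
    show "orthogonal (x + y - (?P x + ?P y)) s" if "s \<in> S" for s
      using P(2)[OF that, of x] P(2)[OF that, of y] unfolding orthogonal_def by (simp add: inner_simps)
  qed
  show "?P (c *\<^sub>R x) = c *\<^sub>R ?P x" for c x
  proof (rule P(3))
    show "c *\<^sub>R ?P x \<in> S" by (intro subspace_scale S P)
    show "orthogonal (c *\<^sub>R x - c *\<^sub>R ?P x) s" if "s \<in> S" for s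
      using P(2)[OF that, of x] unfolding orthogonal_def by (simp add: inner_simps)
  qed
qed

text \<open>Preimages under the projection onto the orthogonal complement are invariant under
  translation by \<open>V\<close>. Transport sets deliver balance in this invariant form.\<close>

lemma balanced_alongI:
  fixes V :: "'a::euclidean_space set"
  assumes V: "subspace V"
    and inv: "\<And>A. A \<in> sets borel \<Longrightarrow> (\<And>x v. x \<in> A \<Longrightarrow> v \<in> V \<Longrightarrow> x + v \<in> A) \<Longrightarrow> \<mu> A = 0"
  shows "balanced_along V \<mu>"
  unfolding balanced_along_def
proof (intro ballI impI inv)
  let ?P = "orthogonal_projection (V\<^sup>\<bottom>)"
  have lin: "linear ?P" by (intro linear_orthogonal_projection subspace_orthogonal_comp)
  fix A :: "'a set" assume A: "A \<in> sets borel"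
  have "continuous_on UNIV ?P" using lin by (simp add: linear_continuous_on linear_linear)
  then have "?P \<in> borel_measurable borel" by (rule borel_measurable_continuous_onI)
  then show "{x. ?P x \<in> A} \<in> sets borel" using measurable_sets[of ?P borel borel A] A by (simp add: vimage_def)
  fix x v assume x: "x \<in> {x. ?P x \<in> A}" and v: "v \<in> V"
  have "?P v = 0"
  proof (rule orthogonal_projection(3)[OF subspace_orthogonal_comp])
    show "0 \<in> V\<^sup>\<bottom>" by (intro subspace_0 subspace_orthogonal_comp)
    show "orthogonal (v - 0) s" if "s \<in> V\<^sup>\<bottom>" for s
      using that v unfolding orthogonal_comp_def by simp
  qed
  then show "x + v \<in> {x. ?P x \<in> A}" using x by (simp add: linear_add[OF lin])
qed

text \<open>A half-space whose normal is orthogonal to \<open>V\<close> is such a preimage; these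
  are the test sets for detecting lack of balance.\<close>

lemma balanced_along_halfspace:
  fixes V :: "'a::euclidean_space set"
  assumes V: "subspace V" and \<theta>: "\<theta> \<in> V\<^sup>\<bottom>" and bal: "balanced_along V \<mu>"
  shows "\<mu> {x. x \<bullet> \<theta> > R} = 0"
proof -
  let ?P = "orthogonal_projection (V\<^sup>\<bottom>)"
  have eq: "?P x \<bullet> \<theta> = x \<bullet> \<theta>" for x
    using orthogonal_projection(2)[OF subspace_orthogonal_comp \<theta>, of x]
    unfolding orthogonal_def by (simp add: inner_diff_left)
  have "V\<^sup>\<bottom> \<inter> {y. y \<bullet> \<theta> > R} \<in> sets borel"
    by (intro sets.Int borel_closed closed_subspace subspace_orthogonal_comp borel_open open_Collect_less continuous_intros)
  then have "\<mu> {x. ?P x \<in> V\<^sup>\<bottom> \<inter> {y. y \<bullet> \<theta> > R}} = 0"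
    using bal unfolding balanced_along_def by blast
  also have "{x. ?P x \<in> V\<^sup>\<bottom> \<inter> {y. y \<bullet> \<theta> > R}} = {x. x \<bullet> \<theta> > R}"
    using orthogonal_projection(1)[OF subspace_orthogonal_comp] by (auto simp: eq)
  finally show ?thesis .
qed

text \<open>Affine maps do not see this pair of balls, yet the larger ball sticks out of the smaller one in
  every direction: adding the pair destroys balance along every proper subspace.\<close>

definition concentric :: "real \<Rightarrow> 'b::group_add \<Rightarrow> ('a::zero \<times> real \<times> 'b) list" where
  "concentric R w = [(0, R, w), (0, 2 * R, - w)]"

lemma concentric_simps [simp]:
  "total_weight (concentric R w) = 0" "positive_radii (concentric R w) \<longleftrightarrow> R > 0"
  unfolding concentric_def by simp_all

text \<open>The half-space beyond height \<open>R\<close> along a unit normal \<theta> orthogonal to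
  \<open>V\<close> misses \<open>l\<close> and the inner ball, but cuts a cap of positive volume off
  the outer one. Its mass is therefore a nonzero multiple of \<open>w\<close>.\<close>

lemma not_balanced_concentric:
  fixes V :: "'a::euclidean_space set" and w :: "'b::real_normed_vector"
  assumes V: "subspace V" "V \<noteq> UNIV" and w: "w \<noteq> 0" and R: "R > 0"
    and l: "\<And>p r w. (p, r, w) \<in> set l \<Longrightarrow> norm p + r \<le> R"
  shows "\<not> balanced_along V (smear (l @ concentric R w))"
proof
  assume bal: "balanced_along V (smear (l @ concentric R w))"
  have "V\<^sup>\<bottom> \<noteq> {0}" using orthogonal_comp_self[OF V(1)] V(2) by auto
  then obtain \<theta>' where \<theta>': "\<theta>' \<in> V\<^sup>\<bottom>" "\<theta>' \<noteq> 0"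
    using subspace_0[OF subspace_orthogonal_comp[of V]] by blast
  define \<theta> where "\<theta> = (1 / norm \<theta>') *\<^sub>R \<theta>'"
  have \<theta>: "\<theta> \<in> V\<^sup>\<bottom>" "norm \<theta> = 1"
    using \<theta>' by (simp_all add: \<theta>_def subspace_scale[OF subspace_orthogonal_comp])
  define H where "H = {x. x \<bullet> \<theta> > R}"
  have empty: "H \<inter> cball p r = {}" if "norm p + r \<le> R" for p r
  proof -
    have "x \<bullet> \<theta> \<le> R" if "x \<in> cball p r" for x
    proof -
      have "x \<bullet> \<theta> \<le> norm x" using norm_cauchy_schwarz[of x \<theta>] \<theta>(2) by simp
      also have "norm x \<le> norm p + r"
        using that norm_triangle_ineq2[of x p] by (simp add: dist_norm norm_minus_commute)
      finally show ?thesis using \<open>norm p + r \<le> R\<close> by simp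
    qed
    then show ?thesis unfolding H_def by fastforce
  qed
  have "smear l H = 0" using l
  proof (induction l)
    case (Cons a l)
    obtain p r v where a: "a = (p, r, v)" by (cases a)
    have "H \<inter> cball p r = {}" using Cons.prems[of p r v] a by (intro empty) simp
    moreover have "smear l H = 0" by (rule Cons.IH, erule Cons.prems[OF list.set_intros(2)])
    ultimately show ?case by (simp add: a)
  qed simp
  then have s: "smear (l @ concentric R w) H =
      - (measure lborel (H \<inter> cball 0 (2 * R)) / measure lborel (cball (0::'a) (2 * R))) *\<^sub>R w"
    using empty[of 0 R] by (simp add: concentric_def)
  \<comment> \<open>This ball lies between the heights \<open>5 / 4 * R\<close> and
    \<open>7 / 4 * R\<close> along \<theta> and its points have norm at most
    \<open>7 / 4 * R\<close>, so it fits into the cap.\<close>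
  have sub: "cball ((3 / 2 * R) *\<^sub>R \<theta>) (R / 4) \<subseteq> H \<inter> cball 0 (2 * R)"
  proof
    fix x assume "x \<in> cball ((3 / 2 * R) *\<^sub>R \<theta>) (R / 4)"
    then have x: "norm (x - (3 / 2 * R) *\<^sub>R \<theta>) \<le> R / 4" by (simp add: dist_norm norm_minus_commute)
    have "\<bar>(x - (3 / 2 * R) *\<^sub>R \<theta>) \<bullet> \<theta>\<bar> \<le> R / 4"
      using Cauchy_Schwarz_ineq2[of "x - (3 / 2 * R) *\<^sub>R \<theta>" \<theta>] x \<theta>(2) by simp
    moreover have "(x - (3 / 2 * R) *\<^sub>R \<theta>) \<bullet> \<theta> = x \<bullet> \<theta> - 3 / 2 * R"
      using \<theta>(2) by (simp add: inner_diff_left dot_square_norm)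
    ultimately have "x \<bullet> \<theta> > R" using R by linarith
    moreover have "norm x \<le> norm (x - (3 / 2 * R) *\<^sub>R \<theta>) + norm ((3 / 2 * R) *\<^sub>R \<theta>)"
      using norm_triangle_ineq[of "x - (3 / 2 * R) *\<^sub>R \<theta>" "(3 / 2 * R) *\<^sub>R \<theta>"] by simp
    ultimately show "x \<in> H \<inter> cball 0 (2 * R)"
      using x R \<theta>(2) by (simp add: H_def)
  qed
  have H: "H \<in> sets borel" unfolding H_def by (intro borel_open open_Collect_less continuous_intros)
  have "H \<inter> cball 0 (2 * R) \<in> fmeasurable lborel"
    using H emeasure_mono[of "H \<inter> cball 0 (2 * R)" "cball 0 (2 * R)" lborel] emeasure_lborel_cball_finite[of "0::'a" "2 * R"]
    by (intro fmeasurableI) auto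
  then have "measure lborel (cball ((3 / 2 * R) *\<^sub>R \<theta>) (R / 4)) \<le> measure lborel (H \<inter> cball 0 (2 * R))"
    using sub by (intro measure_mono_fmeasurable) auto
  then have "measure lborel (H \<inter> cball 0 (2 * R)) > 0"
    using measure_cball_pos[of "R / 4" "(3 / 2 * R) *\<^sub>R \<theta>"] R by linarith
  then have "smear (l @ concentric R w) H \<noteq> 0"
    unfolding s using w R measure_cball_pos[of "2 * R" "0::'a"] by simp
  then show False
    using balanced_along_halfspace[OF V(1) \<theta>(1) bal, of R] unfolding H_def by simp
qed

lemma smear_pairing_concentric_affine:
  "affine_map u \<Longrightarrow> R > 0 \<Longrightarrow> smear_pairing u (concentric R w) = 0"
  for u :: "'a::euclidean_space \<Rightarrow> 'b::euclidean_space"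
  unfolding concentric_def
  using ball_average_affine[of u R w 0] ball_average_affine[of u "2 * R" "- w" 0] by simp

section \<open>Isometric subspaces and affine potentials\<close>

lemma maximal_isometric_subspace_exists:
  fixes N :: "'a::euclidean_space \<Rightarrow> real"
  assumes "is_norm N" "is_norm M"
  obtains V where "maximal_isometric_subspace N M u V"
proof -
  let ?Q = "\<lambda>V. subspace V \<and> isometry_on N M V u"
  \<comment> \<open>The zero subspace always qualifies, and a qualifying subspace of largest
    dimension is maximal for inclusion.\<close>
  have "?Q {0}" using assms by (simp add: subspace_single_0 isometry_on_def is_norm_zero)
  then obtain V where V: "?Q V" "\<And>W. ?Q W \<Longrightarrow> dim W \<le> dim V"
    using ex_has_greatest_nat[of ?Q "{0}" dim "DIM('a) + 1"] dim_subset_UNIV by (metis le_imp_less_Suc Suc_eq_plus1)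
  have "maximal_isometric_subspace N M u V"
    unfolding maximal_isometric_subspace_def
    using V by (metis subspace_dim_equal)
  then show ?thesis by (rule that)
qed

text \<open>For an affine map the relation is translation invariant, so it is encoded by the set
  \<open>E\<close> of vectors whose length the linear part keeps. \<open>E\<close> is closed under
  scaling; closure under addition takes a further argument.\<close>

lemma affine_isometric_pair:
  fixes N :: "'a::euclidean_space \<Rightarrow> real" and M :: "'b::euclidean_space \<Rightarrow> real"
  assumes N: "is_norm N" and M: "is_norm M" and u: "affine_map u"
  obtains E where "\<And>x y. isometric_pair N M u x y \<longleftrightarrow> y - x \<in> E" "\<And>c v. v \<in> E \<Longrightarrow> c *\<^sub>R v \<in> E" "0 \<in> E"
proof -
  obtain L b where L: "linear L" and ub: "\<And>x. u x = L x + b" using u unfolding affine_map_def by blast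
  show ?thesis
  proof (rule that[of "{v. M (L v) = N v}"])
    show "isometric_pair N M u x y \<longleftrightarrow> y - x \<in> {v. M (L v) = N v}" for x y
      unfolding isometric_pair_def
      using is_norm_diff_commute[OF N, of x y] is_norm_diff_commute[OF M, of "L x" "L y"]
      by (simp add: ub linear_diff[OF L])
    show "c *\<^sub>R v \<in> {v. M (L v) = N v}" if "v \<in> {v. M (L v) = N v}" for c v
      using that by (simp add: linear_cmul[OF L] is_norm_scale[OF N] is_norm_scale[OF M])
    show "0 \<in> {v. M (L v) = N v}" by (simp add: linear_0[OF L] is_norm_zero[OF N] is_norm_zero[OF M])
  qed
qed

lemma affine_mass_balance_imp_balanced_along:
  fixes N :: "'a::euclidean_space \<Rightarrow> real" and M :: "'b::euclidean_space \<Rightarrow> real"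
  assumes N: "is_norm N" and M: "is_norm M" and u: "affine_map u"
    and bal: "\<And>A. transport_set N M u A \<Longrightarrow> \<mu> A = 0"
  obtains V where "maximal_isometric_subspace N M u V" "balanced_along V \<mu>"
proof -
  obtain E where E: "\<And>x y. isometric_pair N M u x y \<longleftrightarrow> y - x \<in> E" "\<And>c v. v \<in> E \<Longrightarrow> c *\<^sub>R v \<in> E" "0 \<in> E"
    using affine_isometric_pair[OF N M u] by metis
  have Eneg: "- v \<in> E" if "v \<in> E" for v using E(2)[OF that, of "-1"] by simp
  show ?thesis
  proof (cases "branch_set N M u = UNIV")
    case True
    obtain V where V: "maximal_isometric_subspace N M u V"
      using maximal_isometric_subspace_exists[OF N M] by blast
    \<comment> \<open>With no point off the branch set the transport condition is void.\<close>
    have "transport_set N M u A" if "A \<in> sets borel" for A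
      unfolding transport_set_def using that True by simp
    then have "balanced_along V \<mu>"
      using V bal unfolding maximal_isometric_subspace_def by (intro balanced_alongI) blast+
    then show ?thesis using that V by blast
  next
    case False
    then obtain x where x: "x \<notin> branch_set N M u" by blast
    \<comment> \<open>One point off the branch set is enough: transitivity there is a statement
      about \<open>E\<close> alone, since the relation depends on differences only.\<close>
    have diff: "w - v \<in> E" if vw: "v \<in> E" "w \<in> E" for v w
    proof -
      have "isometric_pair N M u x (x + v)" "isometric_pair N M u x (x + w)" using vw by (simp_all add: E)
      then have "isometric_pair N M u (x + v) (x + w)" using x unfolding branch_set_iff[OF N M] by blast
      then show ?thesis by (simp add: E)
    qed
    have "v + w \<in> E" if "v \<in> E" "w \<in> E" for v w
      using diff[OF Eneg[OF that(1)] that(2)] by (simp add: add.commute)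
    then have sub: "subspace E" using E(2,3) by (simp add: subspace_def)
    have "maximal_isometric_subspace N M u E"
      unfolding maximal_isometric_subspace_def isometry_on_iff_pairs E(1)
    proof (intro conjI sub ballI allI impI)
      show "y - x \<in> E" if "x \<in> E" "y \<in> E" for x y using diff that by blast
      fix W assume W: "subspace W \<and> (\<forall>x\<in>W. \<forall>y\<in>W. y - x \<in> E) \<and> E \<subseteq> W"
      then have "0 \<in> W" using subspace_0 by blast
      then have "w \<in> E" if "w \<in> W" for w using W that by (metis diff_zero)
      then show "W = E" using W by blast
    qed
    moreover have "balanced_along E \<mu>"
    proof (rule balanced_alongI[OF sub])
      fix A assume A: "A \<in> sets borel" and inv: "\<And>x v. x \<in> A \<Longrightarrow> v \<in> E \<Longrightarrow> x + v \<in> A"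
      have "transport_set N M u A"
        unfolding transport_set_def
      proof (intro conjI A ballI allI impI)
        fix x y assume x: "x \<in> A - branch_set N M u" and "M (u x - u y) = N (x - y)"
        then have "y - x \<in> E" using E(1)[of x y] unfolding isometric_pair_def by simp
        then show "y \<in> A" using inv[of x "y - x"] x by simp
      qed
      then show "\<mu> A = 0" by (rule bal)
    qed
    ultimately show ?thesis by (rule that)
  qed
qed

lemma transport_set_isometry:
  assumes N: "is_norm N" and M: "is_norm M"
    and iso: "isometry_on N M UNIV u" and A: "transport_set N M u A"
  shows "A = {} \<or> A = UNIV"
proof -
  have "isometric_pair N M u x y" for x y using iso unfolding isometry_on_iff_pairs by blast
  then have "branch_set N M u = {}" "\<And>x y. M (u x - u y) = N (x - y)"
    using branch_set_iff[OF N M] unfolding isometric_pair_def by blast+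
  then show ?thesis using A unfolding transport_set_def by auto
qed

text \<open>An isometry is injective, so its linear part embeds the source; the bound on the
  dimensions then makes it onto.\<close>

lemma isometry_imp_isometric_norms:
  fixes N :: "'a::euclidean_space \<Rightarrow> real" and M :: "'b::euclidean_space \<Rightarrow> real"
  assumes N: "is_norm N" and M: "is_norm M" and u: "affine_map u"
    and iso: "isometry_on N M UNIV u" and dim: "DIM('b) \<le> DIM('a)"
  shows "DIM('b) = DIM('a) \<and> isometric_norms N M"
proof -
  obtain L b where L: "linear L" and ub: "\<And>x. u x = L x + b" using u unfolding affine_map_def by blast
  have inj: "inj u"
  proof (rule injI)
    fix x y assume "u x = u y"
    then have "N (x - y) = M 0" using iso unfolding isometry_on_def by (metis UNIV_I diff_self)
    then show "x = y" using is_norm_zero[OF M] is_norm_eq_0[OF N, of "x - y"] by simp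
  qed
  then have injL: "inj L" unfolding inj_def by (auto simp: ub)
  then have "dim (range L) = DIM('a)" using dim_image_eq[OF L, of UNIV] by (simp add: inj_on_subset)
  then have *: "dim (range L) = DIM('b)" "DIM('b) = DIM('a)"
    using dim dim_subset_UNIV[of "range L"] by simp_all
  have "range L = UNIV" using *(1) dim_eq_full[of "range L"] span_eq_iff[of "range L"] linear_subspace_image[OF L subspace_UNIV] by simp
  then have "surj u" unfolding surj_def ub by (metis diff_add_cancel surjD)
  then show ?thesis using inj iso *(2) unfolding isometric_norms_def bij_def by blast
qed

section \<open>Mass balance forces affine maps\<close>

text \<open>Inner regularity; it replaces an exceptional set of positive measure by a compact one,
  whose saturation is Borel.\<close>

lemma compact_subset_positive_measure:
  fixes X :: "'a::euclidean_space set"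
  assumes X: "X \<in> sets borel" "bounded X" and pos: "measure lborel X > 0"
  obtains K where "compact K" "K \<subseteq> X" "measure lborel K > 0"
proof -
  have fin: "S \<in> lmeasurable" if "S \<in> sets borel" "S \<subseteq> X" for S
    using that bounded_subset[OF X(2) that(2)] by (intro bounded_set_imp_lmeasurable) auto
  have "X \<in> sets lebesgue" using X by simp
  from sets_lebesgue_inner_closed[OF this pos] obtain T where
    T: "closed T" "T \<subseteq> X" "X - T \<in> lmeasurable" "emeasure lebesgue (X - T) < ennreal (measure lborel X)"
    by blast
  have T': "T \<in> lmeasurable" using T by (intro fin) auto
  have XT: "measure lebesgue (X - T) = measure lebesgue X - measure lebesgue T"
    by (intro measurable_measure_Diff fin X T) (use T' in auto)
  have "measure lebesgue (X - T) < measure lborel X"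
    using T(3,4) pos by (simp add: emeasure_eq_measure2 ennreal_less_iff)
  then have "measure lborel T > 0" using XT X(1) T(1) by simp
  moreover have "compact T" using T(1,2) X(2) bounded_subset compact_eq_bounded_closed by blast
  ultimately show ?thesis using T(2) that by blast
qed

text \<open>By \<open>rel\<close> a transport set occupies equal fractions of the three balls. If
  points of the first ball without partner in another ball had positive measure, a compact set of
  them would generate a transport set missing that ball. So almost every point of the first ball has
  partners in both others, and off the branch set these are partners of each other.\<close>

lemma isometric_triple_exists:
  fixes N :: "'a::euclidean_space \<Rightarrow> real" and M :: "'b::euclidean_space \<Rightarrow> real"
  assumes N: "is_norm N" and M: "is_norm M" and u: "one_lipschitz N M u"
    and bal: "\<And>A. transport_set N M u A \<Longrightarrow> smear [(a, r, wa), (b, r, wb), (c, r, wc)] A = 0"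
    and rel: "\<And>\<alpha> \<beta> \<gamma>. \<alpha> *\<^sub>R wa + (\<beta> *\<^sub>R wb + \<gamma> *\<^sub>R wc) = 0 \<Longrightarrow> \<alpha> = \<beta> \<and> \<alpha> = \<gamma>"
    and r: "r > 0" and disj: "cball a r \<inter> cball b r = {}" "cball a r \<inter> cball c r = {}"
  obtains x y z where "x \<in> cball a r" "y \<in> cball b r" "z \<in> cball c r"
    "isometric_pair N M u x y" "isometric_pair N M u x z" "isometric_pair N M u y z"
proof -
  let ?R = "isometric_pair N M u" and ?B = "branch_set N M u"
  have null: "measure lborel (A \<inter> cball a r) = 0"
    if A: "transport_set N M u A" and q: "q = b \<or> q = c" "A \<inter> cball q r = {}" for A q
  proof -
    let ?f = "\<lambda>p. measure lborel (A \<inter> cball p r) / measure lborel (cball p r)"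
    have "?f a *\<^sub>R wa + (?f b *\<^sub>R wb + ?f c *\<^sub>R wc) = 0" using bal[OF A] by simp
    from rel[OF this] have "?f a = ?f q" using q(1) by auto
    then have "?f a = 0" using q(2) by simp
    then show ?thesis using measure_cball_pos[OF r, of a] by simp
  qed
  define X where "X q = (cball a r - ?B) \<inter> {x. \<forall>y\<in>cball q r. \<not> ?R x y}" for q
  have Xborel: "X q \<in> sets borel" for q
  proof -
    have "closed {(y, x). ?R x y}"
      using closed_isometric_pair[OF N M u, of snd fst]
      by (simp add: case_prod_unfold continuous_on_fst continuous_on_snd)
    from closed_compact_projection[OF compact_cball this, of q r]
    have "closed {x. \<exists>y\<in>cball q r. ?R x y}" by (simp add: Bex_def)
    then have "- {x. \<exists>y\<in>cball q r. ?R x y} \<in> sets borel" by (intro borel_comp borel_closed)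
    also have "- {x. \<exists>y\<in>cball q r. ?R x y} = {x. \<forall>y\<in>cball q r. \<not> ?R x y}" by blast
    finally show ?thesis unfolding X_def
      by (intro sets.Int sets.Diff branch_set_borel[OF N M u]) auto
  qed
  have X0: "measure lborel (X q) = 0" if q: "q = b \<or> q = c" for q
  proof (rule ccontr)
    assume "measure lborel (X q) \<noteq> 0"
    then have pos: "measure lborel (X q) > 0" using measure_nonneg[of lborel "X q"] by linarith
    have "bounded (X q)" unfolding X_def by (rule bounded_subset[OF bounded_cball[of a r]]) blast
    then obtain K where K: "compact K" "K \<subseteq> X q" "measure lborel K > 0"
      using compact_subset_positive_measure[OF Xborel _ pos] by blast
    let ?A = "{y. \<exists>x\<in>K. ?R x y}"
    have "K \<inter> ?B = {}" using K(2) unfolding X_def by blast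
    then have A: "transport_set N M u ?A"
      by (rule transport_set_compact_saturation[OF N M u K(1)])
    have "?A \<inter> cball q r = {}" using K(2) unfolding X_def by blast
    then have "measure lborel (?A \<inter> cball a r) = 0" by (rule null[OF A q])
    moreover have "K \<subseteq> ?A \<inter> cball a r"
      using K(2) isometric_pair_refl[OF N M, of u] unfolding X_def by blast
    moreover have "?A \<inter> cball a r \<in> fmeasurable lborel"
    proof (rule fmeasurableI)
      have "?A \<in> sets borel" using A unfolding transport_set_def by (rule conjunct1)
      then show "?A \<inter> cball a r \<in> sets lborel" by simp
      have "emeasure lborel (?A \<inter> cball a r) \<le> emeasure lborel (cball a r)"
        by (intro emeasure_mono) auto
      then show "emeasure lborel (?A \<inter> cball a r) < \<infinity>"
        using emeasure_lborel_cball_finite[of a r] by (rule order.strict_trans1)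
    qed
    ultimately have "measure lborel K \<le> 0"
      using measure_mono_fmeasurable[of K "?A \<inter> cball a r" lborel] borel_compact[OF K(1)] by simp
    then show False using K(3) by simp
  qed
  have Bb: "?B \<inter> cball a r \<in> sets borel" by (intro sets.Int branch_set_borel[OF N M u]) auto
  \<comment> \<open>A subset of the branch set satisfies the transport condition vacuously. This one
    misses the ball around \<open>b\<close>, so it is null.\<close>
  have "transport_set N M u (?B \<inter> cball a r)" unfolding transport_set_def using Bb by blast
  from null[OF this, of b] have B0: "measure lborel (?B \<inter> cball a r) = 0"
    using disj(1) by (simp add: Int_absorb Int_assoc)
  have "\<not> cball a r \<subseteq> (?B \<inter> cball a r) \<union> (X b \<union> X c)"
  proof
    assume sub: "cball a r \<subseteq> (?B \<inter> cball a r) \<union> (X b \<union> X c)"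
    have nn: "S \<in> null_sets lborel" if "S \<in> sets borel" "S \<subseteq> cball a r" "measure lborel S = 0" for S
    proof -
      have "emeasure lborel S \<noteq> \<infinity>"
        using that emeasure_mono[of S "cball a r" lborel] emeasure_lborel_cball_finite[of a r]
        by (auto simp: top_unique)
      then show ?thesis using that by (simp add: null_sets_def emeasure_eq_ennreal_measure)
    qed
    have "(?B \<inter> cball a r) \<union> (X b \<union> X c) \<in> null_sets lborel"
      by (intro null_sets.Un nn Bb Xborel B0 X0) (auto simp: X_def)
    then have "cball a r \<in> null_sets lborel" by (rule null_sets_subset[OF _ _ sub]) simp
    then show False using measure_cball_pos[OF r, of a] by (simp add: null_sets_def measure_def)
  qed
  then obtain x where x: "x \<in> cball a r" "x \<notin> ?B" "x \<notin> X b" "x \<notin> X c" by blast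
  obtain y where y: "y \<in> cball b r" "?R x y" using x unfolding X_def by blast
  obtain z where z: "z \<in> cball c r" "?R x z" using x unfolding X_def by blast
  have "?R y z" using x(2) y(2) z(2) unfolding branch_set_iff[OF N M] by blast
  then show ?thesis using that x(1) y z by blast
qed

lemma ball_average_lipschitz:
  fixes u :: "'a::euclidean_space \<Rightarrow> 'b::euclidean_space"
  assumes cont: "continuous_on UNIV u" and lip: "\<And>x y. norm (u x - u y) \<le> C * norm (x - y)" and C: "C > 0"
    and r: "r > 0"
  shows "\<bar>ball_average (\<lambda>x. u x \<bullet> w) p r - u p \<bullet> w\<bar> \<le> C * r * norm w"
proof (intro ball_average_bound r continuous_intros cont)
  fix x assume "x \<in> cball p r"
  then have "C * norm (x - p) \<le> C * r" using C by (simp add: dist_norm norm_minus_commute)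
  with lip have "norm (u x - u p) \<le> C * r" by (rule order_trans)
  then have "norm (u x - u p) * norm w \<le> C * r * norm w" by (intro mult_right_mono) auto
  then show "\<bar>u x \<bullet> w - u p \<bullet> w\<bar> \<le> C * r * norm w"
    using Cauchy_Schwarz_ineq2[of "u x - u p" w] by (simp add: inner_diff_left)
qed

lemma affine_if_midpoint_le:
  fixes u :: "'a::real_normed_vector \<Rightarrow> 'b::real_inner"
  assumes cont: "continuous_on UNIV u"
    and le: "\<And>a b w. a \<noteq> b \<Longrightarrow> w \<noteq> 0 \<Longrightarrow> (u a + u b - 2 *\<^sub>R u ((1/2) *\<^sub>R (a + b))) \<bullet> w \<le> 0"
  shows "affine_map u"
proof (rule midpoint_affine_map[OF _ cont])
  fix a b :: 'a
  let ?t = "u a + u b - 2 *\<^sub>R u ((1/2) *\<^sub>R (a + b))"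
  show "?t = 0"
  proof (cases "a = b")
    case True
    then show ?thesis by (simp add: scaleR_2)
  next
    case False
    show ?thesis
    proof (rule ccontr)
      assume t: "?t \<noteq> 0"
      \<comment> \<open>Testing with \<open>w\<close> equal to the second difference itself produces
        its squared norm.\<close>
      then show False using le[OF False t] inner_gt_zero_iff[of ?t] by linarith
    qed
  qed
qed

text \<open>The member \<open>u\<close> competes with optimal potentials whose pairings tend to zero
  along a subsequence, because in the limit they are affine on \<open>a\<close>, \<open>b\<close>
  and the midpoint.\<close>

lemma mass_balance_midpoint_le:
  fixes N :: "real ^ 'n \<Rightarrow> real" and M :: "real ^ 'm \<Rightarrow> real"
  assumes m: "CARD('m) > 1" and N: "is_norm N" and M: "is_strictly_convex_norm M" and ne: "F \<noteq> {}"
    and lip: "\<forall>u\<in>F. one_lipschitz N M u"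
    and closed: "locally_uniformly_closed (up_to_constants F)"
    and bal: "mass_balance N M F"
    and u: "u \<in> F" and ab: "a \<noteq> b" and w: "w \<noteq> 0"
  shows "(u a + u b - 2 *\<^sub>R u ((1/2) *\<^sub>R (a + b))) \<bullet> w \<le> 0"
proof -
  have M': "is_norm M" by (rule strictly_convex_imp_norm[OF M])
  have contF: "continuous_on UNIV f" if "f \<in> F" for f
    using one_lipschitz_continuous[OF N M'] lip that by blast
  obtain C where C: "C > 0" "\<And>f x y. f \<in> F \<Longrightarrow> norm (f x - f y) \<le> C * norm (x - y)"
    using one_lipschitz_bound[OF N M'] lip by metis
  define c where "c = (1/2) *\<^sub>R (a + b)"
  have ac: "a - c = (1/2) *\<^sub>R (a - b)" "b - c = - (1/2) *\<^sub>R (a - b)"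
    unfolding c_def by (simp_all add: vec_eq_iff field_simps)
  \<comment> \<open>A second dimension of the target provides \<open>v\<close>; collinear weights
    would satisfy further linear relations.\<close>
  obtain v where v: "v \<noteq> 0" "orthogonal w v"
    using orthogonal_to_vector_exists[of w] m by auto
  then have vw: "v \<bullet> w = 0" "w \<bullet> v = 0" by (simp_all add: orthogonal_def inner_commute)
  \<comment> \<open>The midpoint has distance \<open>3 * \<delta>\<close> from both ends, so balls
    of radius at most \<delta> are disjoint.\<close>
  define \<delta> where "\<delta> = norm (a - b) / 6"
  have \<delta>: "\<delta> > 0" using ab by (simp add: \<delta>_def)
  define \<epsilon> where "\<epsilon> k = 1 / real (Suc k)" for k
  define r where "r k = \<delta> * \<epsilon> k" for k
  have \<epsilon>: "0 < \<epsilon> k" "\<epsilon> k \<le> 1" for k by (simp_all add: \<epsilon>_def)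
  have r: "0 < r k" "r k \<le> \<delta>" for k
    using \<epsilon>[of k] \<delta> by (simp_all add: r_def mult_left_le)
  have \<epsilon>lim: "\<epsilon> \<longlonglongrightarrow> 0" unfolding \<epsilon>_def using LIMSEQ_Suc[OF lim_1_over_n] by simp
  then have rlim: "r \<longlonglongrightarrow> 0" unfolding r_def using tendsto_mult_right_zero by blast
  \<comment> \<open>The weights add up to zero. The perturbation by \<open>v\<close> leaves no
    linear relation other than equal coefficients, and it fades in the limit.\<close>
  define l where "l k = [(a, r k, w + \<epsilon> k *\<^sub>R v), (b, r k, w - \<epsilon> k *\<^sub>R v), (c, r k, - 2 *\<^sub>R w)]" for k
  have l: "positive_radii (l k)" "total_weight (l k) = 0" for k
    using r by (simp_all add: l_def scaleR_2 algebra_simps)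
  have "\<exists>f x y z. f \<in> F \<and> smear_pairing u (l k) \<le> smear_pairing f (l k) \<and>
      x \<in> cball a (r k) \<and> y \<in> cball b (r k) \<and> z \<in> cball c (r k) \<and>
      isometric_pair N M f x y \<and> isometric_pair N M f x z \<and> isometric_pair N M f y z" for k
  proof -
    obtain f where f: "f \<in> F" "\<And>u. u \<in> F \<Longrightarrow> smear_pairing u (l k) \<le> smear_pairing f (l k)"
      "optimal_potential F (smear (l k)) f"
      using optimal_potential_exists[OF N M' ne lip closed l] by metis
    have "smear (l k) A = 0" if "transport_set N M f A" for A
      using bal smear_W1[OF N M' l] smear_lebesgue_ac f(3) that unfolding mass_balance_def by blast
    then have bal': "smear [(a, r k, w + \<epsilon> k *\<^sub>R v), (b, r k, w - \<epsilon> k *\<^sub>R v), (c, r k, - 2 *\<^sub>R w)] A = 0"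
      if "transport_set N M f A" for A using that unfolding l_def by blast
    \<comment> \<open>The inner product with \<open>v\<close> isolates \<alpha> - \<beta>, the one
      with \<open>w\<close> then gives \<alpha> + \<beta> = 2 \<gamma>.\<close>
    have rel: "\<alpha> = \<beta> \<and> \<alpha> = \<gamma>"
      if z: "\<alpha> *\<^sub>R (w + \<epsilon> k *\<^sub>R v) + (\<beta> *\<^sub>R (w - \<epsilon> k *\<^sub>R v) + \<gamma> *\<^sub>R (- 2 *\<^sub>R w)) = 0" for \<alpha> \<beta> \<gamma>
    proof -
      have "(\<alpha> *\<^sub>R (w + \<epsilon> k *\<^sub>R v) + (\<beta> *\<^sub>R (w - \<epsilon> k *\<^sub>R v) + \<gamma> *\<^sub>R (- 2 *\<^sub>R w))) \<bullet> v = ((\<alpha> - \<beta>) * \<epsilon> k) * (v \<bullet> v)"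
        by (simp add: inner_simps vw algebra_simps)
      then have 1: "\<alpha> = \<beta>" unfolding z using v(1) \<epsilon>(1)[of k] by simp
      have "(\<alpha> *\<^sub>R (w + \<epsilon> k *\<^sub>R v) + (\<beta> *\<^sub>R (w - \<epsilon> k *\<^sub>R v) + \<gamma> *\<^sub>R (- 2 *\<^sub>R w))) \<bullet> w = (\<alpha> + \<beta> - 2 * \<gamma>) * (w \<bullet> w)"
        by (simp add: inner_simps vw algebra_simps)
      then have "\<alpha> + \<beta> - 2 * \<gamma> = 0" unfolding z using w by simp
      then show ?thesis using 1 by simp
    qed
    have "norm (a - c) = 3 * \<delta>" using ac(1) by (simp add: \<delta>_def)
    moreover have "norm (a - b) = 6 * \<delta>" by (simp add: \<delta>_def)
    ultimately have "cball a (r k) \<inter> cball b (r k) = {}" "cball a (r k) \<inter> cball c (r k) = {}"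
      using r[of k] \<delta> by (simp_all add: disjoint_cballI dist_norm)
    then obtain x y z where "x \<in> cball a (r k)" "y \<in> cball b (r k)" "z \<in> cball c (r k)"
      "isometric_pair N M f x y" "isometric_pair N M f x z" "isometric_pair N M f y z"
      using isometric_triple_exists[OF N M' _ bal' rel r(1)] lip f(1) by metis
    then show ?thesis using f(1,2) u by blast
  qed
  then obtain f x y z where f: "\<And>k. f k \<in> F" "\<And>k. smear_pairing u (l k) \<le> smear_pairing (f k) (l k)"
    and xyz: "\<And>k. x k \<in> cball a (r k)" "\<And>k. y k \<in> cball b (r k)" "\<And>k. z k \<in> cball c (r k)"
    and iso: "\<And>k. isometric_pair N M (f k) (x k) (y k)" "\<And>k. isometric_pair N M (f k) (x k) (z k)"
      "\<And>k. isometric_pair N M (f k) (y k) (z k)"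
    by metis
  \<comment> \<open>The pairing with the point masses themselves; as the weights add up to zero,
    only differences to the value at \<open>c\<close> enter. \<open>W\<close> below bounds the sum
    of the norms of the weights.\<close>
  define D where "D k p q = (p \<bullet> (w + \<epsilon> k *\<^sub>R v) + q \<bullet> (w - \<epsilon> k *\<^sub>R v))" for k p q
  define W where "W = 4 * norm w + 2 * norm v"
  have approx: "\<bar>smear_pairing g (l k) - D k (g a - g c) (g b - g c)\<bar> \<le> C * r k * W" if g: "g \<in> F" for g k
  proof -
    note avg = ball_average_lipschitz[OF contF[OF g] C(2)[OF g] C(1) r(1)[of k]]
    let ?w1 = "w + \<epsilon> k *\<^sub>R v" and ?w2 = "w - \<epsilon> k *\<^sub>R v" and ?w3 = "- 2 *\<^sub>R w"
    have ev: "norm (\<epsilon> k *\<^sub>R v) \<le> norm v" using \<epsilon>[of k] by (simp add: mult_left_le_one_le)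
    have "norm ?w1 + norm ?w2 + norm ?w3 \<le> W"
      using norm_triangle_ineq[of w "\<epsilon> k *\<^sub>R v"] norm_triangle_ineq4[of w "\<epsilon> k *\<^sub>R v"] ev
      unfolding W_def by simp
    then have "C * r k * (norm ?w1 + norm ?w2 + norm ?w3) \<le> C * r k * W"
      using C(1) r(1)[of k] by (intro mult_left_mono) auto
    then have "C * r k * norm ?w1 + C * r k * norm ?w2 + C * r k * norm ?w3 \<le> C * r k * W"
      by (simp add: distrib_left)
    moreover have "smear_pairing g (l k) = ball_average (\<lambda>x. g x \<bullet> ?w1) a (r k) +
        ball_average (\<lambda>x. g x \<bullet> ?w2) b (r k) + ball_average (\<lambda>x. g x \<bullet> ?w3) c (r k)"
      unfolding l_def smear_pairing_simps by simp
    moreover have "D k (g a - g c) (g b - g c) = g a \<bullet> ?w1 + g b \<bullet> ?w2 + g c \<bullet> ?w3"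
      by (simp add: D_def inner_simps algebra_simps)
    ultimately show ?thesis using avg[of ?w1 a] avg[of ?w2 b] avg[of ?w3 c] by linarith
  qed
  have le: "D k (u a - u c) (u b - u c) \<le> D k (f k a - f k c) (f k b - f k c) + 2 * (C * r k * W)" for k
    using approx[OF u, of k] approx[OF f(1)[of k], of k] f(2)[of k] by linarith
  \<comment> \<open>The values of \<open>f k\<close> may diverge, but their differences to the value
    at \<open>c\<close> are bounded by the Lipschitz constant. The limit of these two vectors
    carries all the information used, so no limit map is constructed.\<close>
  define P where "P k = (f k a - f k c, f k b - f k c)" for k
  have "norm (P k) \<le> C * norm (a - c) + C * norm (b - c)" for k
    using norm_Pair_le[of "f k a - f k c" "f k b - f k c"] C(2)[OF f(1)[of k], of a c] C(2)[OF f(1)[of k], of b c]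
    unfolding P_def by linarith
  then have "P k \<in> cball 0 (C * norm (a - c) + C * norm (b - c))" for k by simp
  then obtain L s where s: "strict_mono (s :: nat \<Rightarrow> nat)" and L: "(P \<circ> s) \<longlonglongrightarrow> L"
    using compact_cball unfolding compact_def by metis
  define \<alpha> \<beta> where "\<alpha> = fst L" and "\<beta> = snd L"
  have lim: "(\<lambda>k. f (s k) a - f (s k) c) \<longlonglongrightarrow> \<alpha>" "(\<lambda>k. f (s k) b - f (s k) c) \<longlonglongrightarrow> \<beta>"
    using tendsto_fst[OF L] tendsto_snd[OF L] by (simp_all add: P_def \<alpha>_def \<beta>_def o_def)
  have rs: "(\<lambda>k. r (s k)) \<longlonglongrightarrow> 0" and \<epsilon>s: "(\<lambda>k. \<epsilon> (s k)) \<longlonglongrightarrow> 0"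
    using LIMSEQ_subseq_LIMSEQ[OF rlim s] LIMSEQ_subseq_LIMSEQ[OF \<epsilon>lim s] by (simp_all add: o_def)
  have close: "(\<lambda>k. p (s k)) \<longlonglongrightarrow> q \<and> (\<lambda>k. f (s k) (p (s k)) - f (s k) q) \<longlonglongrightarrow> 0"
    if "\<And>k. p k \<in> cball q (r k)" for p q
  proof
    have d: "norm (p k - q) \<le> r k" for k using that[of k] by (simp add: dist_norm norm_minus_commute)
    have "(\<lambda>k. p (s k) - q) \<longlonglongrightarrow> 0"
      by (rule Lim_null_comparison[OF _ rs]) (simp add: d)
    then show "(\<lambda>k. p (s k)) \<longlonglongrightarrow> q" by (simp add: LIM_zero_iff)
    have n: "norm (f (s k) (p (s k)) - f (s k) q) \<le> C * r (s k)" for k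
      by (rule order_trans[OF C(2)[OF f(1)] mult_left_mono[OF d less_imp_le[OF C(1)]]])
    have "(\<lambda>k. C * r (s k)) \<longlonglongrightarrow> 0" by (rule tendsto_mult_right_zero[OF rs])
    then show "(\<lambda>k. f (s k) (p (s k)) - f (s k) q) \<longlonglongrightarrow> 0"
      by (rule Lim_null_comparison[OF always_eventually[OF allI[OF n]]])
  qed
  \<comment> \<open>As the radii shrink, the partners converge to the centres, and the common
    Lipschitz bound lets \<open>f k\<close> be evaluated at the centres instead.\<close>
  have isolim: "M \<gamma> = N (q - q')"
    if p: "\<And>k. p k \<in> cball q (r k)" "\<And>k. p' k \<in> cball q' (r k)"
      and i: "\<And>k. isometric_pair N M (f k) (p k) (p' k)" and \<gamma>: "(\<lambda>k. f (s k) q - f (s k) q') \<longlonglongrightarrow> \<gamma>"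
    for p p' q q' \<gamma>
  proof -
    have "(\<lambda>k. (f (s k) (p (s k)) - f (s k) q) - (f (s k) (p' (s k)) - f (s k) q') + (f (s k) q - f (s k) q'))
        \<longlonglongrightarrow> 0 - 0 + \<gamma>"
      by (intro tendsto_add tendsto_diff \<gamma> conjunct2[OF close[OF p(1)]] conjunct2[OF close[OF p(2)]])
    then have 1: "(\<lambda>k. f (s k) (p (s k)) - f (s k) (p' (s k))) \<longlonglongrightarrow> \<gamma>" by simp
    have "(\<lambda>k. M (f (s k) (p (s k)) - f (s k) (p' (s k)))) \<longlonglongrightarrow> M \<gamma>"
      by (rule continuous_on_tendsto_compose[OF is_norm_continuous[OF M'] 1]) auto
    moreover have "(\<lambda>k. N (p (s k) - p' (s k))) \<longlonglongrightarrow> N (q - q')"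
      by (rule continuous_on_tendsto_compose[OF is_norm_continuous[OF N]])
        (auto intro!: tendsto_diff conjunct1[OF close[OF p(1)]] conjunct1[OF close[OF p(2)]])
    ultimately show ?thesis
      using i unfolding isometric_pair_def by (simp add: LIMSEQ_unique)
  qed
  have "(\<lambda>k. (f (s k) a - f (s k) c) - (f (s k) b - f (s k) c)) \<longlonglongrightarrow> \<alpha> - \<beta>" by (intro tendsto_diff lim)
  then have "M (\<alpha> - \<beta>) = N (a - b)" by (intro isolim[OF xyz(1,2) iso(1)]) simp
  moreover have "M \<alpha> = N (a - c)" by (rule isolim[OF xyz(1,3) iso(2) lim(1)])
  moreover have "M \<beta> = N (b - c)" by (rule isolim[OF xyz(2,3) iso(3) lim(2)])
  \<comment> \<open>The vectors \<alpha> and - \<beta> have norm \<open>N (a - b) / 2\<close> and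
    their sum has norm \<open>N (a - b)\<close>, the equality case of the triangle inequality. It
    makes the limit in \<open>upper\<close> vanish.\<close>
  ultimately have "\<alpha> = - \<beta>"
    unfolding ac
    by (intro strictly_convex_norm_eq[OF M, of _ "N (a - b) / 2"])
      (simp_all add: is_norm_scale[OF N] is_norm_minus[OF N] is_norm_minus[OF M'] del: scaleR_minus_left)
  have upper: "(\<lambda>k. D (s k) (f (s k) a - f (s k) c) (f (s k) b - f (s k) c) + 2 * (C * r (s k) * W))
      \<longlonglongrightarrow> (\<alpha> \<bullet> (w + 0 *\<^sub>R v) + \<beta> \<bullet> (w - 0 *\<^sub>R v)) + 2 * (C * 0 * W)"
    unfolding D_def by (intro tendsto_intros lim rs \<epsilon>s)
  have lower: "(\<lambda>k. D (s k) (u a - u c) (u b - u c))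
      \<longlonglongrightarrow> (u a - u c) \<bullet> (w + 0 *\<^sub>R v) + (u b - u c) \<bullet> (w - 0 *\<^sub>R v)"
    unfolding D_def by (intro tendsto_intros \<epsilon>s)
  have "(u a - u c) \<bullet> (w + 0 *\<^sub>R v) + (u b - u c) \<bullet> (w - 0 *\<^sub>R v)
      \<le> (\<alpha> \<bullet> (w + 0 *\<^sub>R v) + \<beta> \<bullet> (w - 0 *\<^sub>R v)) + 2 * (C * 0 * W)"
    by (rule LIMSEQ_le[OF lower upper]) (use le in blast)
  then show ?thesis unfolding c_def[symmetric] using \<open>\<alpha> = - \<beta>\<close>
    by (simp add: inner_simps)
qed

section \<open>Moments\<close>

text \<open>For \<open>B\<close> inside \<open>A\<close> the pair \<open>{B, A - B}\<close> is an
  admissible partition, so the total variation dominates each single value. Applied to the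
  components of \<mu> and their negatives, it gives the Jordan parts finite first moments.\<close>

lemma positive_part_le_total_variation:
  fixes \<mu> :: "'a::topological_space set \<Rightarrow> 'b::euclidean_space" and \<nu> :: "'a set \<Rightarrow> real"
  assumes M: "is_norm M" and \<mu>: "vector_measure \<mu>" and \<nu>: "vector_measure \<nu>"
    and K: "K \<ge> 0" "\<And>B. \<nu> B \<le> K * M (\<mu> B)"
  shows "positive_part \<nu> \<le> scale_measure (ennreal K) (total_variation M \<mu>)"
proof (subst le_measure, simp, intro ballI)
  fix A assume "A \<in> sets (positive_part \<nu>)"
  then have A: "A \<in> sets borel" by simp
  show "emeasure (positive_part \<nu>) A \<le> emeasure (scale_measure (ennreal K) (total_variation M \<mu>)) A"
    unfolding emeasure_positive_part[OF \<nu> A]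
  proof (rule SUP_least)
    fix B assume B: "B \<in> {B \<in> sets borel. B \<subseteq> A}"
    let ?P = "{B, A - B}"
    have "ennreal (M (\<mu> B)) \<le> (\<Sum>X\<in>?P. ennreal (M (\<mu> X)))" by (rule member_le_sum) auto
    also have "\<dots> \<le> emeasure (total_variation M \<mu>) A"
      unfolding emeasure_total_variation[OF M \<mu> A]
      using A B by (intro SUP_upper) (auto simp: disjoint_def)
    finally have *: "ennreal (M (\<mu> B)) \<le> emeasure (total_variation M \<mu>) A" .
    have "ennreal (\<nu> B) \<le> ennreal K * ennreal (M (\<mu> B))"
      using K by (simp add: ennreal_leI flip: ennreal_mult')
    also have "\<dots> \<le> emeasure (scale_measure (ennreal K) (total_variation M \<mu>)) A"
      using * by (simp add: mult_left_mono)
    finally show "ennreal (\<nu> B) \<le> emeasure (scale_measure (ennreal K) (total_variation M \<mu>)) A" .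
  qed
qed

lemma integrable_positive_part_component:
  fixes \<mu> :: "(real ^ 'n) set \<Rightarrow> 'b::euclidean_space"
  assumes N: "is_norm N" and M: "is_norm M" and W: "\<mu> \<in> W1 N M" and \<nu>: "vector_measure \<nu>"
    and K: "K \<ge> 0" "\<And>B. \<nu> B \<le> K * M (\<mu> B)"
  shows "integrable (positive_part \<nu>) (\<lambda>x. x $ j)"
proof (rule integrableI_bounded)
  have \<mu>: "vector_measure \<mu>" using W unfolding W1_def by blast
  obtain x0 where x0: "(\<integral>\<^sup>+x. ennreal (N (x - x0)) \<partial>total_variation M \<mu>) < \<infinity>"
    using W unfolding W1_def by blast
  obtain c where c: "c > 0" "\<And>x. c * norm x \<le> N x" using is_norm_lower[OF N] by blast
  interpret finite_measure "positive_part \<nu>" by (rule finite_measure_positive_part[OF \<nu>])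
  have [measurable]: "(\<lambda>x. N (x - x0)) \<in> borel_measurable borel"
    by (intro borel_measurable_continuous_onI is_norm_continuous_on[OF N] continuous_intros)
  show "(\<lambda>x. x $ j) \<in> borel_measurable (positive_part \<nu>)" by simp
  have "(\<integral>\<^sup>+x. ennreal (norm (x $ j)) \<partial>positive_part \<nu>) \<le>
      (\<integral>\<^sup>+x. ennreal (1 / c) * ennreal (N (x - x0)) + ennreal (norm x0) \<partial>positive_part \<nu>)"
  proof (rule nn_integral_mono)
    fix x
    have "norm (x $ j) \<le> norm (x - x0) + norm x0"
      using component_le_norm_cart[of x j] norm_triangle_ineq[of "x - x0" x0] by simp
    also have "norm (x - x0) \<le> (1 / c) * N (x - x0)" using c by (simp add: field_simps)
    finally have "ennreal (norm (x $ j)) \<le> ennreal ((1 / c) * N (x - x0) + norm x0)" by (intro ennreal_leI) simp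
    also have "\<dots> = ennreal (1 / c) * ennreal (N (x - x0)) + ennreal (norm x0)"
      using c(1) is_norm_nonneg[OF N, of "x - x0"]
      by (subst ennreal_plus) (simp_all flip: ennreal_mult')
    finally show "ennreal (norm (x $ j)) \<le> ennreal (1 / c) * ennreal (N (x - x0)) + ennreal (norm x0)" .
  qed
  also have "\<dots> = ennreal (1 / c) * (\<integral>\<^sup>+x. ennreal (N (x - x0)) \<partial>positive_part \<nu>)
      + ennreal (norm x0) * emeasure (positive_part \<nu>) UNIV"
    by (subst nn_integral_add) (simp_all add: nn_integral_cmult)
  also have "\<dots> < \<infinity>"
  proof -
    have "(\<integral>\<^sup>+x. ennreal (N (x - x0)) \<partial>positive_part \<nu>) \<le>
        (\<integral>\<^sup>+x. ennreal (N (x - x0)) \<partial>scale_measure (ennreal K) (total_variation M \<mu>))"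
      by (intro nn_integral_mono_measure positive_part_le_total_variation[OF M \<mu> \<nu> K]) simp
    also have "\<dots> = ennreal K * (\<integral>\<^sup>+x. ennreal (N (x - x0)) \<partial>total_variation M \<mu>)"
      by (rule nn_integral_scale_measure) simp
    also have "\<dots> < \<infinity>" using x0 by (simp add: ennreal_mult_less_top)
    finally show ?thesis by (simp add: ennreal_mult_eq_top_iff less_top[symmetric])
  qed
  finally show "(\<integral>\<^sup>+x. ennreal (norm (x $ j)) \<partial>positive_part \<nu>) < \<infinity>" .
qed

text \<open>\<open>T j\<close> is the first moment of \<mu> in the coordinate \<open>j\<close>. The
  constant part of \<open>u\<close> drops out because the two Jordan parts of each component have
  equal mass.\<close>

lemma vector_integral_affine:
  fixes N :: "real ^ 'n \<Rightarrow> real" and M :: "real ^ 'm \<Rightarrow> real"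
  assumes N: "is_norm N" and M: "is_norm M" and W: "\<mu> \<in> W1 N M"
  obtains T :: "'n \<Rightarrow> real ^ 'm" where
    "\<And>u. affine_map u \<Longrightarrow> vector_integral u \<mu> = (\<Sum>j\<in>UNIV. (u (axis j 1) - u 0) \<bullet> T j)"
proof -
  have \<mu>: "vector_measure \<mu>" and \<mu>0: "\<mu> UNIV = 0" using W unfolding W1_def by blast+
  define \<nu> where "\<nu> i A = \<mu> A $ i" for i A
  have \<nu>: "vector_measure (\<nu> i)" "vector_measure (\<lambda>A. - \<nu> i A)" "\<nu> i UNIV = 0" for i
    unfolding \<nu>_def using vector_measure_component[OF \<mu>] \<mu>0 by (simp_all add: vector_measure_uminus)
  obtain c where c: "c > 0" "\<And>x. c * norm x \<le> M x" using is_norm_lower[OF M] by blast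
  have b: "\<bar>\<nu> i B\<bar> \<le> (1 / c) * M (\<mu> B)" for i B
    using component_le_norm_cart[of "\<mu> B" i] c(2)[of "\<mu> B"] c(1) unfolding \<nu>_def
    by (simp add: pos_le_divide_eq mult.commute[of _ c]) (meson mult_left_mono less_imp_le order_trans)
  have int: "integrable (positive_part (\<nu> i)) (\<lambda>x. x $ j)" "integrable (positive_part (\<lambda>A. - \<nu> i A)) (\<lambda>x. x $ j)" for i j
    using b[of i] c(1)
    by (intro integrable_positive_part_component[OF N M W, of _ "1 / c"] \<nu>; force simp: abs_le_iff)+
  have fin: "finite_measure (positive_part (\<nu> i))" "finite_measure (positive_part (\<lambda>A. - \<nu> i A))" for i
    by (intro finite_measure_positive_part \<nu>)+
  have mass: "measure (positive_part (\<lambda>A. - \<nu> i A)) UNIV = measure (positive_part (\<nu> i)) UNIV" for i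
    using emeasure_positive_part_uminus_UNIV[OF \<nu>(1,3)] by (simp add: measure_def)
  have lin: "signed_integral (\<lambda>x. d + (\<Sum>j\<in>UNIV. e j * x $ j)) (\<nu> i) =
      (\<Sum>j\<in>UNIV. e j * signed_integral (\<lambda>x. x $ j) (\<nu> i))" for i d and e :: "'n \<Rightarrow> real"
  proof -
    have *: "(LINT x|P. d + (\<Sum>j\<in>UNIV. e j * x $ j)) = d * measure P UNIV + (\<Sum>j\<in>UNIV. e j * (LINT x|P. x $ j))"
      if "finite_measure P" "space P = UNIV" "\<And>j. integrable P (\<lambda>x. x $ j)" for P :: "(real ^ 'n) measure"
    proof -
      have "integrable P (\<lambda>x. d)" using finite_measure.integrable_const[OF that(1)] .
      moreover have "integrable P (\<lambda>x. \<Sum>j\<in>UNIV. e j * x $ j)" using that(3) by simp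
      ultimately show ?thesis using that(2,3) by simp
    qed
    show ?thesis unfolding signed_integral_def
      by (simp add: *[OF fin(1) _ int(1)] *[OF fin(2) _ int(2)] mass sum_subtractf right_diff_distrib)
  qed
  define T where "T j = (\<chi> i. signed_integral (\<lambda>x. x $ j) (\<nu> i))" for j
  have "vector_integral u \<mu> = (\<Sum>j\<in>UNIV. (u (axis j 1) - u 0) \<bullet> T j)" if u: "affine_map u" for u
  proof -
    obtain L b where L: "linear L" and ub: "\<And>x. u x = L x + b" using u unfolding affine_map_def by blast
    have ui: "u x $ i = b $ i + (\<Sum>j\<in>UNIV. L (axis j 1) $ i * x $ j)" for x i
    proof -
      have "L x = L (\<Sum>j\<in>UNIV. x $ j *\<^sub>R axis j 1)" by (simp add: basis_expansion[of x, unfolded scalar_mult_eq_scaleR])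
      also have "\<dots> = (\<Sum>j\<in>UNIV. x $ j *\<^sub>R L (axis j 1))" by (simp add: linear_sum[OF L] linear_cmul[OF L])
      finally show ?thesis by (simp add: ub mult.commute)
    qed
    have "vector_integral u \<mu> = (\<Sum>i\<in>UNIV. \<Sum>j\<in>UNIV. L (axis j 1) $ i * T j $ i)"
      unfolding vector_integral_def ui \<nu>_def[symmetric] lin by (simp add: T_def)
    also have "\<dots> = (\<Sum>j\<in>UNIV. \<Sum>i\<in>UNIV. L (axis j 1) $ i * T j $ i)" by (rule sum.swap)
    also have "\<dots> = (\<Sum>j\<in>UNIV. (u (axis j 1) - u 0) \<bullet> T j)"
      by (simp add: inner_vec_def ub linear_0[OF L])
    finally show ?thesis .
  qed
  then show ?thesis by (rule that)
qed

section \<open>Balanced potentials force affine maps\<close>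

text \<open>The concentric pair excludes balance along every proper subspace, so the maximal
  subspace is the whole space.\<close>

lemma balanced_potentials_imp_isometry:
  fixes N :: "real ^ 'n \<Rightarrow> real" and M :: "real ^ 'm \<Rightarrow> real"
  assumes N: "is_norm N" and M: "is_norm M"
    and bal: "\<And>\<mu> u0. \<mu> \<in> W1 N M \<Longrightarrow> lebesgue_ac \<mu> \<Longrightarrow> optimal_potential F \<mu> u0 \<Longrightarrow>
         \<exists>V. maximal_isometric_subspace N M u0 V \<and> balanced_along V \<mu>"
    and l: "positive_radii l" "total_weight l = 0" "\<And>p r w. (p, r, w) \<in> set l \<Longrightarrow> norm p + r \<le> R"
    and R: "R > 0" and w: "w \<noteq> 0"
    and opt: "optimal_potential F (smear (l @ concentric R w)) u"
  shows "isometry_on N M UNIV u"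
proof -
  have "smear (l @ concentric R w) \<in> W1 N M" by (rule smear_W1[OF N M]) (use l R in auto)
  from bal[OF this smear_lebesgue_ac opt] obtain V where
    V: "maximal_isometric_subspace N M u V" "balanced_along V (smear (l @ concentric R w))" by blast
  have sub: "subspace V" and iso: "isometry_on N M V u"
    using V(1) unfolding maximal_isometric_subspace_def by simp_all
  have "V = UNIV"
  proof (rule ccontr)
    assume "V \<noteq> UNIV"
    with sub have "\<not> balanced_along V (smear (l @ concentric R w))"
      using w R l(3) by (rule not_balanced_concentric)
    then show False using V(2) by (rule notE)
  qed
  then show ?thesis using iso by simp
qed

lemma balanced_potentials_imp_affine:
  fixes N :: "real ^ 'n \<Rightarrow> real" and M :: "real ^ 'm \<Rightarrow> real"
  assumes N: "is_norm N" and M: "is_strictly_convex_norm M" and ne: "F \<noteq> {}"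
    and lip: "\<forall>u\<in>F. one_lipschitz N M u"
    and closed: "locally_uniformly_closed (up_to_constants F)"
    and bal: "\<And>\<mu> u0. \<mu> \<in> W1 N M \<Longrightarrow> lebesgue_ac \<mu> \<Longrightarrow> optimal_potential F \<mu> u0 \<Longrightarrow>
         \<exists>V. maximal_isometric_subspace N M u0 V \<and> balanced_along V \<mu>"
    and u: "u \<in> F"
  shows "affine_map u"
proof -
  have M': "is_norm M" by (rule strictly_convex_imp_norm[OF M])
  have cont: "continuous_on UNIV u" using one_lipschitz_continuous[OF N M'] lip u by blast
  obtain C where C: "C > 0" "\<And>f x y. f \<in> F \<Longrightarrow> norm (f x - f y) \<le> C * norm (x - y)"
    using one_lipschitz_bound[OF N M'] lip by metis
  \<comment> \<open>The optimal potential is an isometry of the whole space, hence affine, and pairs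
    to zero with a measure that annihilates affine maps. So the optimal value is 0, and
    \<open>u\<close> stays below it.\<close>
  have key: "smear_pairing u (l @ concentric R w) \<le> 0"
    if l: "positive_radii l" "total_weight l = 0" "\<And>p r w. (p, r, w) \<in> set l \<Longrightarrow> norm p + r \<le> R"
      and R: "R > 0" and w: "w \<noteq> 0" and aff: "\<And>f. affine_map f \<Longrightarrow> smear_pairing f l = 0" for l R w
  proof -
    have "positive_radii (l @ concentric R w)" "total_weight (l @ concentric R w) = 0"
      using l R by simp_all
    then obtain f where f: "\<And>u. u \<in> F \<Longrightarrow> smear_pairing u (l @ concentric R w) \<le> smear_pairing f (l @ concentric R w)"
      "optimal_potential F (smear (l @ concentric R w)) f"
      using optimal_potential_exists[OF N M' ne lip closed] by metis
    have "isometry_on N M UNIV f"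
      by (rule balanced_potentials_imp_isometry[OF N M' bal l R w f(2)])
    then have "affine_map f" by (rule isometry_affine_map[OF N M])
    then have "smear_pairing f (l @ concentric R w) = 0"
      by (simp add: aff smear_pairing_concentric_affine[OF _ R])
    then show ?thesis using f(1)[OF u] by simp
  qed
  show ?thesis
  proof (rule affine_if_midpoint_le[OF cont])
    fix a b :: "real ^ 'n" and w :: "real ^ 'm" assume w: "w \<noteq> 0"
    define c where "c = (1/2) *\<^sub>R (a + b)"
    \<comment> \<open>The weights \<open>w\<close>, \<open>w\<close> and \<open>-2 w\<close> have
      norms adding up to \<open>4 * norm w\<close>; the smoothing error disappears as
      \<open>r\<close> tends to 0.\<close>
    have "(u a + u b - 2 *\<^sub>R u c) \<bullet> w \<le> C * r * (4 * norm w)" if r: "r > 0" for r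
    proof -
      define R where "R = norm a + norm b + norm c + r"
      have R: "R > 0" using r norm_ge_zero[of a] norm_ge_zero[of b] norm_ge_zero[of c] unfolding R_def by linarith
      define l where "l = [(a, r, w), (b, r, w), (c, r, - 2 *\<^sub>R w)]"
      have aff: "smear_pairing f l = 0" if f_aff: "affine_map f" for f
      proof -
        obtain L d where L: "linear L" and f: "\<And>x. f x = L x + d" using f_aff unfolding affine_map_def by blast
        have "f c = (1/2) *\<^sub>R (f a + f b)"
          unfolding f c_def by (simp add: linear_add[OF L] linear_cmul[OF L] scaleR_add_right flip: scaleR_left_distrib)
        then show ?thesis unfolding l_def smear_pairing_simps ball_average_affine[OF f_aff r]
          by (simp add: inner_simps field_simps)
      qed
      have "smear_pairing u (l @ concentric R w) \<le> 0"
      proof (rule key[OF _ _ _ R w aff])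
        show "norm p + r' \<le> R" if "(p, r', w') \<in> set l" for p r' w'
          using that unfolding l_def R_def by auto
      qed (use r in \<open>simp_all add: l_def scaleR_2\<close>)
      \<comment> \<open>The concentric pair alone, with opposite weight, gives the bound by which
        its contribution is removed from the previous inequality.\<close>
      moreover have "smear_pairing u ([] @ concentric R (- w)) \<le> 0" by (rule key[OF _ _ _ R]) (use w in auto)
      moreover have "smear_pairing u (concentric R (- w)) = - smear_pairing u (concentric R w)"
        unfolding concentric_def smear_pairing_simps
        using ball_average_cmult[of "-1" "\<lambda>x. u x \<bullet> w" 0] by simp
      ultimately have "smear_pairing u l \<le> 0" by simp
      moreover have "smear_pairing u l = ball_average (\<lambda>x. u x \<bullet> w) a r + ball_average (\<lambda>x. u x \<bullet> w) b r
          + ball_average (\<lambda>x. u x \<bullet> (- 2 *\<^sub>R w)) c r"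
        unfolding l_def smear_pairing_simps by simp
      moreover note avg = ball_average_lipschitz[OF cont C(2)[OF u] C(1) r]
      have "C * r * norm (- 2 *\<^sub>R w) = 2 * (C * r * norm w)" by simp
      ultimately have "u a \<bullet> w + u b \<bullet> w + u c \<bullet> (- 2 *\<^sub>R w) \<le> 4 * (C * r * norm w)"
        using avg[of w a] avg[of w b] avg[of "- 2 *\<^sub>R w" c] by linarith
      then show ?thesis by (simp add: inner_simps algebra_simps)
    qed
    note bound = this
    have "(\<lambda>k. C * (1 / real (Suc k)) * (4 * norm w)) \<longlonglongrightarrow> C * 0 * (4 * norm w)"
      by (intro tendsto_intros LIMSEQ_Suc[OF lim_1_over_n])
    moreover have "(u a + u b - 2 *\<^sub>R u c) \<bullet> w \<le> C * (1 / real (Suc k)) * (4 * norm w)" for k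
      by (rule bound) simp
    ultimately have "(u a + u b - 2 *\<^sub>R u c) \<bullet> w \<le> C * 0 * (4 * norm w)"
      by (intro LIMSEQ_le_const) blast+
    then show "(u a + u b - 2 *\<^sub>R u ((1/2) *\<^sub>R (a + b))) \<bullet> w \<le> 0" by (simp add: c_def)
  qed
qed

lemma balanced_potentials_imp_mass_balance:
  fixes N :: "real ^ 'n \<Rightarrow> real" and M :: "real ^ 'm \<Rightarrow> real"
  assumes N: "is_norm N" and M: "is_strictly_convex_norm M" and ne: "F \<noteq> {}"
    and lip: "\<forall>u\<in>F. one_lipschitz N M u"
    and closed: "locally_uniformly_closed (up_to_constants F)"
    and bal: "\<And>\<mu> u0. \<mu> \<in> W1 N M \<Longrightarrow> lebesgue_ac \<mu> \<Longrightarrow> optimal_potential F \<mu> u0 \<Longrightarrow>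
         \<exists>V. maximal_isometric_subspace N M u0 V \<and> balanced_along V \<mu>"
  shows "mass_balance N M F"
  unfolding mass_balance_def
proof (intro ballI impI allI)
  fix \<mu> u0 A
  assume W: "\<mu> \<in> W1 N M" and opt: "optimal_potential F \<mu> u0" and A: "transport_set N M u0 A"
  have M': "is_norm M" by (rule strictly_convex_imp_norm[OF M])
  have aff: "affine_map u" if "u \<in> F" for u
    by (rule balanced_potentials_imp_affine[OF N M ne lip closed bal that])
  have cont: "continuous_on UNIV u" if "u \<in> F" for u using one_lipschitz_continuous[OF N M'] lip that by blast
  obtain T :: "'n \<Rightarrow> real ^ 'm" where
    T: "\<And>u. affine_map u \<Longrightarrow> vector_integral u \<mu> = (\<Sum>j\<in>UNIV. (u (axis j 1) - u 0) \<bullet> T j)"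
    using vector_integral_affine[OF N M' W] by blast
  obtain js :: "'n list" where js: "set js = UNIV" "distinct js" using finite_distinct_list[OF finite[of "UNIV :: 'n set"]] by blast
  \<comment> \<open>A dipole with weight \<open>T j\<close> at the unit vector and
    \<open>- T j\<close> at the origin, for each coordinate, reproduces the first moments of \<mu>.
    Smearing leaves pairings with affine maps unchanged.\<close>
  define l where "l = concat (map (\<lambda>j. [(axis j (1 :: real), 1 :: real, T j), (0, 1, - T j)]) js)"
  have l: "positive_radii l" "total_weight l = 0"
    unfolding l_def by (induction js) auto
  \<comment> \<open>Any nonzero weight serves; \<open>undefined\<close> is an arbitrary
    coordinate.\<close>
  define w :: "real ^ 'm" where "w = axis undefined 1"
  have w: "w \<noteq> 0" by (simp add: w_def axis_eq_0_iff)
  have pair: "smear_pairing u l = vector_integral u \<mu>" if u: "affine_map u" for u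
  proof -
    have "smear_pairing u (concat (map (\<lambda>j. [(axis j (1 :: real), 1 :: real, T j), (0, 1, - T j)]) js))
        = (\<Sum>j\<leftarrow>js. (u (axis j 1) - u 0) \<bullet> T j)" for js
      using ball_average_affine[OF u, of 1]
      by (induction js) (simp_all add: inner_diff_left del: inner_minus_right, simp)
    then show ?thesis unfolding T[OF u] l_def using js by (simp add: sum_list_distinct_conv_sum_set)
  qed
  \<comment> \<open>The radius 2 suffices for the concentric pair, since the balls of
    \<open>l\<close> have centres of norm at most 1 and radius 1.\<close>
  have "vector_integral u (smear (l @ concentric 2 w)) = vector_integral u \<mu>" if "u \<in> F" for u
    using vector_integral_smear[OF cont[OF that], of "l @ concentric 2 w"] l pair[OF aff[OF that]]
      smear_pairing_concentric_affine[OF aff[OF that], of 2 w] by simp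
  then have opt': "optimal_potential F (smear (l @ concentric 2 w)) u0"
    using opt unfolding optimal_potential_iff by simp
  have "isometry_on N M UNIV u0"
    by (rule balanced_potentials_imp_isometry[OF N M' bal l _ _ w opt']) (auto simp: l_def)
  \<comment> \<open>The transport sets of an isometry are \<open>{}\<close> and \<open>UNIV\<close>,
    and \<open>\<mu> UNIV = 0\<close>.\<close>
  from transport_set_isometry[OF N M' this A] show "\<mu> A = 0"
    using W vector_measure_empty unfolding W1_def by blast
qed

section \<open>Assembly of the two implications\<close>

theorem theorem7:
  fixes N :: "real ^ 'n \<Rightarrow> real"
    and M :: "real ^ 'm \<Rightarrow> real"
    and F :: "(real ^ 'n \<Rightarrow> real ^ 'm) set"
  assumes "CARD('m) \<le> CARD('n)"
    and "is_norm N"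
    and "is_strictly_convex_norm M"
    and "F \<noteq> {}"
    and "\<forall>u\<in>F. one_lipschitz N M u"
    and "locally_uniformly_closed (up_to_constants F)"
  shows
    "(mass_balance N M F \<longrightarrow>
        (CARD('m) = 1 \<or>
         CARD('m) > 1 \<and> (\<forall>u\<in>F. affine_map u) \<and> CARD('m) = CARD('n) \<and> isometric_norms N M) \<and>
        (\<forall>\<mu> \<in> W1 N M. \<forall>u0. optimal_potential F \<mu> u0 \<longrightarrow>
           (\<exists>V. maximal_isometric_subspace N M u0 V)) \<and>
        (\<forall>\<mu> \<in> W1 N M. lebesgue_ac \<mu> \<longrightarrow> (\<exists>V. subspace V \<and> balanced_along V \<mu>)) \<and>
        (CARD('m) > 1 \<longrightarrow>
           (\<forall>\<mu> \<in> W1 N M. lebesgue_ac \<mu> \<longrightarrow> (\<forall>u0. optimal_potential F \<mu> u0 \<longrightarrow>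
              (\<exists>V. maximal_isometric_subspace N M u0 V \<and> balanced_along V \<mu>))))) \<and>
     ((\<forall>\<mu> \<in> W1 N M. lebesgue_ac \<mu> \<longrightarrow> (\<forall>u0. optimal_potential F \<mu> u0 \<longrightarrow>
         (\<exists>V. maximal_isometric_subspace N M u0 V \<and> balanced_along V \<mu>))) \<longrightarrow>
      mass_balance N M F)"
proof (intro conjI impI)
  note N = assms(2) and M = assms(3) and ne = assms(4) and lip = assms(5) and closed = assms(6)
  have M': "is_norm M" by (rule strictly_convex_imp_norm[OF M])
  show "mass_balance N M F"
    if "\<forall>\<mu> \<in> W1 N M. lebesgue_ac \<mu> \<longrightarrow> (\<forall>u0. optimal_potential F \<mu> u0 \<longrightarrow>
         (\<exists>V. maximal_isometric_subspace N M u0 V \<and> balanced_along V \<mu>))"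
    using that by (intro balanced_potentials_imp_mass_balance[OF N M ne lip closed]) blast
  show "\<forall>\<mu> \<in> W1 N M. \<forall>u0. optimal_potential F \<mu> u0 \<longrightarrow> (\<exists>V. maximal_isometric_subspace N M u0 V)"
    using maximal_isometric_subspace_exists[OF N M'] by metis
  show "\<forall>\<mu> \<in> W1 N M. lebesgue_ac \<mu> \<longrightarrow> (\<exists>V. subspace V \<and> balanced_along V \<mu>)"
  proof (intro ballI impI exI conjI)
    fix \<mu> assume \<mu>: "\<mu> \<in> W1 N M"
    \<comment> \<open>The whole space serves as subspace: its invariant sets are \<open>{}\<close>
      and \<open>UNIV\<close>, both of mass zero.\<close>
    show "balanced_along UNIV \<mu>"
    proof (rule balanced_alongI)
      fix A :: "(real ^ 'n) set" assume inv: "\<And>x v. x \<in> A \<Longrightarrow> v \<in> UNIV \<Longrightarrow> x + v \<in> A"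
      have "A = {} \<or> A = UNIV"
      proof (cases "A = {}")
        case False
        then obtain x where "x \<in> A" by blast
        then have "y \<in> A" for y using inv[of x "y - x"] by simp
        then show ?thesis by blast
      qed simp
      then show "\<mu> A = 0" using \<mu> vector_measure_empty unfolding W1_def by blast
    qed simp
  qed simp
  assume bal: "mass_balance N M F"
  have aff: "affine_map u" if m: "CARD('m) > 1" and u: "u \<in> F" for u
    by (rule affine_if_midpoint_le[OF one_lipschitz_continuous[OF N M' bspec[OF lip u]]])
      (rule mass_balance_midpoint_le[OF m N M ne lip closed bal u])
  have pot: "\<exists>V. maximal_isometric_subspace N M u0 V \<and> balanced_along V \<mu>"
    if "CARD('m) > 1" and \<mu>: "\<mu> \<in> W1 N M" "lebesgue_ac \<mu>" and opt: "optimal_potential F \<mu> u0" for \<mu> u0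
  proof -
    have u0: "u0 \<in> F" using opt unfolding optimal_potential_def by blast
    have "\<mu> A = 0" if "transport_set N M u0 A" for A
      using bal \<mu> opt that unfolding mass_balance_def by blast
    then show ?thesis
      using affine_mass_balance_imp_balanced_along[OF N M' aff[OF that(1) u0]] by metis
  qed
  then show "\<forall>\<mu> \<in> W1 N M. lebesgue_ac \<mu> \<longrightarrow> (\<forall>u0. optimal_potential F \<mu> u0 \<longrightarrow>
      (\<exists>V. maximal_isometric_subspace N M u0 V \<and> balanced_along V \<mu>))" if "CARD('m) > 1" using that by blast
  show "CARD('m) = 1 \<or>
      CARD('m) > 1 \<and> (\<forall>u\<in>F. affine_map u) \<and> CARD('m) = CARD('n) \<and> isometric_norms N M"
  proof (cases "CARD('m) > 1")
    case True
    define w :: "real ^ 'm" where "w = axis undefined 1"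
    have w: "w \<noteq> 0" by (simp add: w_def axis_eq_0_iff)
    \<comment> \<open>The concentric pair by itself is not balanced along any proper subspace, so
      its optimal potential is an isometry of the whole space.\<close>
    have "positive_radii ([] @ concentric 1 w :: ((real ^ 'n) \<times> real \<times> (real ^ 'm)) list)"
      "total_weight ([] @ concentric 1 w :: ((real ^ 'n) \<times> real \<times> (real ^ 'm)) list) = 0"
      by simp_all
    then obtain u where u: "u \<in> F" "optimal_potential F (smear ([] @ concentric 1 w)) u"
      using optimal_potential_exists[OF N M' ne lip closed] by metis
    have "isometry_on N M UNIV u"
      by (rule balanced_potentials_imp_isometry[OF N M' pot[OF True] _ _ _ _ w u(2)]) auto
    from isometry_imp_isometric_norms[OF N M' aff[OF True u(1)] this]
    show ?thesis using True aff[OF True] assms(1) by simp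
  next
    case False
    moreover have "CARD('m) > 0" by simp
    ultimately show ?thesis by linarith
  qed
qed

end
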